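(* Let $C$ and $D$ be coalgebras over a field $k$ and let $\Psi: C\otimes D\to D\otimes C$ be a twist map which is a morphism in the category ${}^{D}M^{C}$. Then $\Psi$ is conormal if and only if $\Psi$ is the flip map $\tau: c\otimes d\mapsto d\otimes c$.
   Context: All coalgebras are coassociative and counital over the field $k$, with Sweedler notation $\Delta(c)=c_{(1)}\otimes c_{(2)}$. A twist map is a $k$-linear map $C\otimes D\to D\otimes C$. ${}^{D}M^{C}$ is the category of left $D$- right $C$-comodules with commuting coactions, whose morphisms are linear maps that are both left $D$-colinear and right $C$-colinear. $D\otimes C$ is an object via the coactions $\Delta_D\otimes\mathrm{id}_C$ and $\mathrm{id}_D\otimes\Delta_C$; $C\otimes D$ is an object via the left $D$-coaction $c\otimes d\mapsto d_{(1)}\otimes c\otimes d_{(2)}$ and the right $C$-coaction $c\otimes d\mapsto c_{(1)}\otimes d\otimes c_{(2)}$. A twist $\Psi$ is conormal if $(\varepsilon_D\otimes\mathrm{id}_C)\Psi=\mathrm{id}_C\otimes\varepsilon_D$ and $(\mathrm{id}_D\otimes\varepsilon_C)\Psi=\varepsilon_C\otimes\mathrm{id}_D$. *)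

theory Defs
  imports "HOL-Algebra.AbelCoset" "Jordan_Normal_Form.Missing_VectorSpace"
begin

section \<open>Tensor products of vector spaces\<close>

text \<open>The free vector space on \<open>S\<close>: finitely supported functions on \<open>S\<close>.\<close>

definition free_vs :: "('k, 'm) ring_scheme \<Rightarrow> 's set \<Rightarrow> ('k, 's \<Rightarrow> 'k) module" where
  "free_vs K S = (ring.func_space K S)
     \<lparr>carrier := {f \<in> S \<rightarrow>\<^sub>E carrier K. finite {s \<in> S. f s \<noteq> \<zero>\<^bsub>K\<^esub>}}\<rparr>"

definition free_gen :: "('k, 'm) ring_scheme \<Rightarrow> 's set \<Rightarrow> 's \<Rightarrow> 's \<Rightarrow> 'k" where
  "free_gen K S s = restrict (\<lambda>t. if t = s then \<one>\<^bsub>K\<^esub> else \<zero>\<^bsub>K\<^esub>) S"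

text \<open>In \<open>smult\<close> all the cosets in the union coincide.\<close>

definition quotient_vs :: "('k, 'v, 'n) module_scheme \<Rightarrow> 'v set \<Rightarrow> ('k, 'v set) module" where
  "quotient_vs V N = \<lparr>carrier = a_rcosets\<^bsub>V\<^esub> N, mult = (\<lambda>_ _. N), one = N, zero = N,
     add = (<+>\<^bsub>V\<^esub>), smult = (\<lambda>a X. \<Union>x\<in>X. N +>\<^bsub>V\<^esub> (a \<odot>\<^bsub>V\<^esub> x))\<rparr>"

definition tensor_relations ::
  "('k, 'm) ring_scheme \<Rightarrow> ('k, 'v, 'n) module_scheme \<Rightarrow> ('k, 'w, 'p) module_scheme \<Rightarrow>
   ('v \<times> 'w \<Rightarrow> 'k) set" where
  "tensor_relations K V W =
    (let S = carrier V \<times> carrier W; F = free_vs K S; e = free_gen K S in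
       {e (v \<oplus>\<^bsub>V\<^esub> v', w) \<ominus>\<^bsub>F\<^esub> (e (v, w) \<oplus>\<^bsub>F\<^esub> e (v', w)) | v v' w.
          v \<in> carrier V \<and> v' \<in> carrier V \<and> w \<in> carrier W}
     \<union> {e (v, w \<oplus>\<^bsub>W\<^esub> w') \<ominus>\<^bsub>F\<^esub> (e (v, w) \<oplus>\<^bsub>F\<^esub> e (v, w')) | v w w'.
          v \<in> carrier V \<and> w \<in> carrier W \<and> w' \<in> carrier W}
     \<union> {e (a \<odot>\<^bsub>V\<^esub> v, w) \<ominus>\<^bsub>F\<^esub> (a \<odot>\<^bsub>F\<^esub> e (v, w)) | a v w.
          a \<in> carrier K \<and> v \<in> carrier V \<and> w \<in> carrier W}
     \<union> {e (v, a \<odot>\<^bsub>W\<^esub> w) \<ominus>\<^bsub>F\<^esub> (a \<odot>\<^bsub>F\<^esub> e (v, w)) | a v w.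
          a \<in> carrier K \<and> v \<in> carrier V \<and> w \<in> carrier W})"

definition tensor_null ::
  "('k, 'm) ring_scheme \<Rightarrow> ('k, 'v, 'n) module_scheme \<Rightarrow> ('k, 'w, 'p) module_scheme \<Rightarrow>
   ('v \<times> 'w \<Rightarrow> 'k) set" where
  "tensor_null K V W =
     module.span K (free_vs K (carrier V \<times> carrier W)) (tensor_relations K V W)"

definition tensor ::
  "('k, 'm) ring_scheme \<Rightarrow> ('k, 'v, 'n) module_scheme \<Rightarrow> ('k, 'w, 'p) module_scheme \<Rightarrow>
   ('k, ('v \<times> 'w \<Rightarrow> 'k) set) module" where
  "tensor K V W = quotient_vs (free_vs K (carrier V \<times> carrier W)) (tensor_null K V W)"

definition pure_tensor ::
  "('k, 'm) ring_scheme \<Rightarrow> ('k, 'v, 'n) module_scheme \<Rightarrow> ('k, 'w, 'p) module_scheme \<Rightarrow>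
   'v \<Rightarrow> 'w \<Rightarrow> ('v \<times> 'w \<Rightarrow> 'k) set" where
  "pure_tensor K V W v w =
     tensor_null K V W +>\<^bsub>free_vs K (carrier V \<times> carrier W)\<^esub>
       free_gen K (carrier V \<times> carrier W) (v, w)"

definition bilinear_map ::
  "('k, 'm) ring_scheme \<Rightarrow> ('k, 'v, 'n) module_scheme \<Rightarrow> ('k, 'w, 'p) module_scheme \<Rightarrow>
   ('k, 'x, 'q) module_scheme \<Rightarrow> ('v \<Rightarrow> 'w \<Rightarrow> 'x) \<Rightarrow> bool" where
  "bilinear_map K V W X \<beta> \<longleftrightarrow>
     (\<forall>v\<in>carrier V. \<beta> v \<in> module_hom K W X) \<and>
     (\<forall>w\<in>carrier W. (\<lambda>v. \<beta> v w) \<in> module_hom K V X)"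

text \<open>The linear map on \<open>V \<otimes> W\<close> induced by a bilinear map \<open>\<beta>\<close>; existence and uniqueness are
  \<open>tensor_universal\<close> below. Values outside the carrier are fixed by extensionality.\<close>

definition tensor_lift ::
  "('k, 'm) ring_scheme \<Rightarrow> ('k, 'v, 'n) module_scheme \<Rightarrow> ('k, 'w, 'p) module_scheme \<Rightarrow>
   ('k, 'x, 'q) module_scheme \<Rightarrow> ('v \<Rightarrow> 'w \<Rightarrow> 'x) \<Rightarrow> ('v \<times> 'w \<Rightarrow> 'k) set \<Rightarrow> 'x" where
  "tensor_lift K V W X \<beta> =
     (THE h. h \<in> module_hom K (tensor K V W) X \<and> h \<in> extensional (carrier (tensor K V W)) \<and>
        (\<forall>v\<in>carrier V. \<forall>w\<in>carrier W. h (pure_tensor K V W v w) = \<beta> v w))"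

subsection \<open>The universal property\<close>

lemma free_vs_sel [simp]:
  assumes "ring K"
  shows "carrier (free_vs K S) = {f \<in> S \<rightarrow>\<^sub>E carrier K. finite {s \<in> S. f s \<noteq> \<zero>\<^bsub>K\<^esub>}}"
    "\<zero>\<^bsub>free_vs K S\<^esub> = restrict (\<lambda>_. \<zero>\<^bsub>K\<^esub>) S"
    "f \<oplus>\<^bsub>free_vs K S\<^esub> g = restrict (\<lambda>v. f v \<oplus>\<^bsub>K\<^esub> g v) S"
    "c \<odot>\<^bsub>free_vs K S\<^esub> f = restrict (\<lambda>v. c \<otimes>\<^bsub>K\<^esub> f v) S"
  by (simp_all add: free_vs_def ring.func_space_def[OF assms])

lemma module_free_vs:
  fixes K (structure)
  assumes "cring K"
  shows "module K (free_vs K S)"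
proof -
  interpret cring K by fact
  interpret FS: module K "func_space S" by (rule func_space_is_module)
  let ?N = "{f \<in> S \<rightarrow>\<^sub>E carrier K. finite {s \<in> S. f s \<noteq> \<zero>\<^bsub>K\<^esub>}}"
  have "submodule K ?N (func_space S)"
  proof (rule submodule.intro)
    show "module K (func_space S)" by (rule func_space_is_module)
    show "?N \<subseteq> carrier (func_space S)" by (auto simp: func_space_def)
    show "\<zero>\<^bsub>func_space S\<^esub> \<in> ?N" by (auto simp: func_space_def)
  next
    fix v w assume v: "v \<in> ?N" and w: "w \<in> ?N"
    have "{s \<in> S. v s \<oplus> w s \<noteq> \<zero>} \<subseteq> {s \<in> S. v s \<noteq> \<zero>} \<union> {s \<in> S. w s \<noteq> \<zero>}"
      using v w by auto
    then have "finite {s \<in> S. v s \<oplus> w s \<noteq> \<zero>}"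
      using v w by (auto intro: finite_subset)
    then show "v \<oplus>\<^bsub>func_space S\<^esub> w \<in> ?N"
      using v w by (auto simp: func_space_def PiE_mem cong: conj_cong)
  next
    fix c v assume c: "c \<in> carrier K" and v: "v \<in> ?N"
    have "{s \<in> S. c \<otimes> v s \<noteq> \<zero>} \<subseteq> {s \<in> S. v s \<noteq> \<zero>}"
      using c v by auto
    then have "finite {s \<in> S. c \<otimes> v s \<noteq> \<zero>}"
      using v by (auto intro: finite_subset)
    then show "c \<odot>\<^bsub>func_space S\<^esub> v \<in> ?N"
      using c v by (auto simp: func_space_def PiE_mem cong: conj_cong)
  qed
  then show ?thesis
    unfolding free_vs_def by (rule FS.submodule_is_module)
qed

lemma free_gen_closed:
  assumes "cring K" "s \<in> S"
  shows "free_gen K S s \<in> carrier (free_vs K S)"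
proof -
  interpret cring K by fact
  have "{t \<in> S. free_gen K S s t \<noteq> \<zero>\<^bsub>K\<^esub>} \<subseteq> {s}"
    by (auto simp: free_gen_def)
  then have "finite {t \<in> S. free_gen K S s t \<noteq> \<zero>\<^bsub>K\<^esub>}"
    using finite_subset by blast
  then show ?thesis
    by (auto simp: ring_axioms free_gen_def)
qed

lemma module_homI:
  assumes "\<And>x. x \<in> carrier M \<Longrightarrow> f x \<in> carrier N"
    and "\<And>x y. x \<in> carrier M \<Longrightarrow> y \<in> carrier M \<Longrightarrow> f (x \<oplus>\<^bsub>M\<^esub> y) = f x \<oplus>\<^bsub>N\<^esub> f y"
    and "\<And>a x. a \<in> carrier R \<Longrightarrow> x \<in> carrier M \<Longrightarrow> f (a \<odot>\<^bsub>M\<^esub> x) = a \<odot>\<^bsub>N\<^esub> f x"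
  shows "f \<in> module_hom R M N"
  using assms by (auto simp: module_hom_def)

lemma module_hom_mem: "f \<in> module_hom R M N \<Longrightarrow> x \<in> carrier M \<Longrightarrow> f x \<in> carrier N"
  by (auto simp: module_hom_def)

lemma module_hom_comp:
  "f \<in> module_hom R M N \<Longrightarrow> g \<in> module_hom R N P \<Longrightarrow> (\<lambda>x. g (f x)) \<in> module_hom R M P"
  by (auto simp: module_hom_def Pi_def)

lemma module_hom_id: "(\<lambda>x. x) \<in> module_hom R M M"
  by (auto simp: module_hom_def)

lemma module_hom_restrict:
  assumes "module R M" "f \<in> module_hom R M N"
  shows "restrict f (carrier M) \<in> module_hom R M N"
proof -
  interpret module R M by fact
  show ?thesis using assms(2) by (auto simp: module_hom_def Pi_def)
qed

lemma module_hom_ext_free: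
  fixes K (structure)
  assumes K: "cring K" and X: "module K X"
    and h: "h \<in> module_hom K (free_vs K S) X" and h': "h' \<in> module_hom K (free_vs K S) X"
    and eq: "\<And>s. s \<in> S \<Longrightarrow> h (free_gen K S s) = h' (free_gen K S s)"
    and f: "f \<in> carrier (free_vs K S)"
  shows "h f = h' f"
proof -
  interpret cring K by fact
  interpret F: module K "free_vs K S" by (rule module_free_vs[OF K])
  interpret H: mod_hom K "free_vs K S" X h
    by (intro mod_hom.intro mod_hom_axioms.intro X h F.module_axioms)
  interpret H': mod_hom K "free_vs K S" X h'
    by (intro mod_hom.intro mod_hom_axioms.intro X h' F.module_axioms)
  have "\<forall>f. f \<in> carrier (free_vs K S) \<longrightarrow> {s \<in> S. f s \<noteq> \<zero>} \<subseteq> A \<longrightarrow> h f = h' f"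
    if "finite A" for A
    using that
  proof (induction A)
    case empty
    show ?case
    proof (intro allI impI)
      fix f assume "f \<in> carrier (free_vs K S)" "{s \<in> S. f s \<noteq> \<zero>} \<subseteq> {}"
      then have "f = \<zero>\<^bsub>free_vs K S\<^esub>"
        by (auto simp: ring_axioms PiE_def extensional_def)
      then show "h f = h' f" using H.f0_is_0 H'.f0_is_0 by metis
    qed
  next
    case (insert s A)
    show ?case
    proof (intro allI impI)
      fix f assume f: "f \<in> carrier (free_vs K S)" and sub: "{t \<in> S. f t \<noteq> \<zero>} \<subseteq> insert s A"
      show "h f = h' f"
      proof (cases "s \<in> S")
        case False
        then have "{t \<in> S. f t \<noteq> \<zero>} \<subseteq> A" using sub by auto
        then show ?thesis using insert.IH f by blast
      next
        case True
        have fmem: "\<And>t. t \<in> S \<Longrightarrow> f t \<in> carrier K"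
          using f by (auto simp: ring_axioms)
        define g where "g = restrict (\<lambda>t. if t = s then \<zero> else f t) S"
        have "{t \<in> S. g t \<noteq> \<zero>} \<subseteq> {t \<in> S. f t \<noteq> \<zero>}" by (auto simp: g_def)
        then have "finite {t \<in> S. g t \<noteq> \<zero>}"
          using f by (auto simp: ring_axioms intro: finite_subset)
        then have g: "g \<in> carrier (free_vs K S)"
          using f by (auto simp: ring_axioms g_def)
        have gs: "{t \<in> S. g t \<noteq> \<zero>} \<subseteq> A" using sub by (auto simp: g_def)
        have e: "free_gen K S s \<in> carrier (free_vs K S)" by (rule free_gen_closed[OF K True])
        have fs: "f s \<in> carrier K" using fmem True by auto
        have dec: "f = f s \<odot>\<^bsub>free_vs K S\<^esub> free_gen K S s \<oplus>\<^bsub>free_vs K S\<^esub> g"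
        proof
          fix t
          show "f t = (f s \<odot>\<^bsub>free_vs K S\<^esub> free_gen K S s \<oplus>\<^bsub>free_vs K S\<^esub> g) t"
            using f fmem True
            by (cases "t \<in> S") (auto simp: ring_axioms g_def free_gen_def PiE_def extensional_def)
        qed
        have "h (f s \<odot>\<^bsub>free_vs K S\<^esub> free_gen K S s \<oplus>\<^bsub>free_vs K S\<^esub> g)
            = h' (f s \<odot>\<^bsub>free_vs K S\<^esub> free_gen K S s \<oplus>\<^bsub>free_vs K S\<^esub> g)"
          using insert.IH g gs e fs eq[OF True]
          by (simp only: H.f_add H'.f_add H.f_smult H'.f_smult F.smult_closed)
        then show ?thesis using dec by simp
      qed
    qed
  qed
  moreover have "finite {s \<in> S. f s \<noteq> \<zero>}" using f by (auto simp: ring_axioms)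
  ultimately show ?thesis using f by blast
qed

lemma free_lift_exists:
  fixes K (structure)
  assumes K: "cring K" and X: "module K X" and b: "\<And>s. s \<in> S \<Longrightarrow> b s \<in> carrier X"
  obtains h where "h \<in> module_hom K (free_vs K S) X" "\<And>s. s \<in> S \<Longrightarrow> h (free_gen K S s) = b s"
proof -
  interpret X: module K X by fact
  define h where "h f = (\<Oplus>\<^bsub>X\<^esub>s\<in>{s\<in>S. f s \<noteq> \<zero>}. f s \<odot>\<^bsub>X\<^esub> b s)" for f
  have ring: "ring K" by (rule X.R.ring_axioms)
  have mem: "f s \<in> carrier K" if "f \<in> carrier (free_vs K S)" "s \<in> S" for f s
    using that by (auto simp: ring)
  have big: "h f = (\<Oplus>\<^bsub>X\<^esub>s\<in>A. f s \<odot>\<^bsub>X\<^esub> b s)"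
    if f: "\<And>s. s \<in> S \<Longrightarrow> f s \<in> carrier K"
      and A: "finite A" "A \<subseteq> S" "{s\<in>S. f s \<noteq> \<zero>} \<subseteq> A" for f A
    unfolding h_def
    by (rule X.M.add.finprod_mono_neutral_cong_left)
       (use A f b in \<open>auto simp: subset_iff\<close>)
  have "h \<in> module_hom K (free_vs K S) X"
  proof (rule module_homI)
    fix f assume f: "f \<in> carrier (free_vs K S)"
    show "h f \<in> carrier X"
      unfolding h_def using mem[OF f] b by (auto intro!: X.M.finsum_closed)
  next
    fix f g assume f: "f \<in> carrier (free_vs K S)" and g: "g \<in> carrier (free_vs K S)"
    let ?A = "{s\<in>S. f s \<noteq> \<zero>} \<union> {s\<in>S. g s \<noteq> \<zero>}"
    have A: "finite ?A" "?A \<subseteq> S" using f g by (auto simp: ring)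
    have "h (f \<oplus>\<^bsub>free_vs K S\<^esub> g) = (\<Oplus>\<^bsub>X\<^esub>s\<in>?A. (f \<oplus>\<^bsub>free_vs K S\<^esub> g) s \<odot>\<^bsub>X\<^esub> b s)"
      by (rule big) (use A mem[OF f] mem[OF g] in \<open>auto simp: ring\<close>)
    also have "\<dots> = (\<Oplus>\<^bsub>X\<^esub>s\<in>?A. f s \<odot>\<^bsub>X\<^esub> b s \<oplus>\<^bsub>X\<^esub> g s \<odot>\<^bsub>X\<^esub> b s)"
      by (rule X.M.finsum_cong')
         (use mem[OF f] mem[OF g] b in \<open>auto simp: ring X.smult_l_distr\<close>)
    also have "\<dots> = (\<Oplus>\<^bsub>X\<^esub>s\<in>?A. f s \<odot>\<^bsub>X\<^esub> b s) \<oplus>\<^bsub>X\<^esub> (\<Oplus>\<^bsub>X\<^esub>s\<in>?A. g s \<odot>\<^bsub>X\<^esub> b s)"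
      by (rule X.M.finsum_addf) (use mem[OF f] mem[OF g] b in auto)
    also have "(\<Oplus>\<^bsub>X\<^esub>s\<in>?A. f s \<odot>\<^bsub>X\<^esub> b s) = h f"
      by (rule big[symmetric]) (use A mem[OF f] in auto)
    also have "(\<Oplus>\<^bsub>X\<^esub>s\<in>?A. g s \<odot>\<^bsub>X\<^esub> b s) = h g"
      by (rule big[symmetric]) (use A mem[OF g] in auto)
    finally show "h (f \<oplus>\<^bsub>free_vs K S\<^esub> g) = h f \<oplus>\<^bsub>X\<^esub> h g" .
  next
    fix a f assume a: "a \<in> carrier K" and f: "f \<in> carrier (free_vs K S)"
    let ?A = "{s\<in>S. f s \<noteq> \<zero>}"
    have A: "finite ?A" "?A \<subseteq> S" using f by (auto simp: ring)
    have "h (a \<odot>\<^bsub>free_vs K S\<^esub> f) = (\<Oplus>\<^bsub>X\<^esub>s\<in>?A. (a \<odot>\<^bsub>free_vs K S\<^esub> f) s \<odot>\<^bsub>X\<^esub> b s)"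
      by (rule big) (use A a mem[OF f] in \<open>auto simp: ring\<close>)
    also have "\<dots> = (\<Oplus>\<^bsub>X\<^esub>s\<in>?A. a \<odot>\<^bsub>X\<^esub> (f s \<odot>\<^bsub>X\<^esub> b s))"
      by (rule X.M.finsum_cong')
         (use mem[OF f] a b in \<open>auto simp: ring X.smult_assoc1\<close>)
    also have "\<dots> = a \<odot>\<^bsub>X\<^esub> h f"
      unfolding h_def
      by (rule X.finsum_smult_ldistr[symmetric]) (use A a mem[OF f] b in auto)
    finally show "h (a \<odot>\<^bsub>free_vs K S\<^esub> f) = a \<odot>\<^bsub>X\<^esub> h f" .
  qed
  moreover have "h (free_gen K S s) = b s" if s: "s \<in> S" for s
  proof -
    have "h (free_gen K S s) = (\<Oplus>\<^bsub>X\<^esub>t\<in>{s}. free_gen K S s t \<odot>\<^bsub>X\<^esub> b t)"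
      by (rule big) (use s in \<open>auto simp: free_gen_def\<close>)
    then show ?thesis using s b by (simp add: free_gen_def)
  qed
  ultimately show ?thesis by (rule that)
qed

context
  fixes K (structure) and V N
  assumes sub: "submodule K N V"
begin

interpretation V: module K V by (rule submodule.module[OF sub])

lemma quotient_abelian_subgroup: "abelian_subgroup N V"
proof (rule abelian_subgroupI3)
  interpret N: submodule K N V by (rule sub)
  show "additive_subgroup N V"
  proof (rule additive_subgroupI, rule V.M.add.subgroupI)
    show "N \<noteq> {}" using N.zero_closed by blast
    fix a assume a: "a \<in> N"
    have "(\<ominus> \<one>) \<odot>\<^bsub>V\<^esub> a \<in> N" using a by (intro N.smult_closed) auto
    moreover have "a \<in> carrier V" using N.subset a by auto
    ultimately show "\<ominus>\<^bsub>V\<^esub> a \<in> N" using V.smult_minus_1 by metis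
  qed (use N.subset in auto)
  show "abelian_group V" by (rule V.M.abelian_group_axioms)
qed

interpretation A: abelian_subgroup N V by (rule quotient_abelian_subgroup)

lemma quotient_sel:
  shows "carrier (quotient_vs V N) = (\<lambda>x. N +>\<^bsub>V\<^esub> x) ` carrier V"
    and "\<zero>\<^bsub>quotient_vs V N\<^esub> = N +>\<^bsub>V\<^esub> \<zero>\<^bsub>V\<^esub>"
    and "x \<in> carrier V \<Longrightarrow> y \<in> carrier V \<Longrightarrow>
      (N +>\<^bsub>V\<^esub> x) \<oplus>\<^bsub>quotient_vs V N\<^esub> (N +>\<^bsub>V\<^esub> y) = N +>\<^bsub>V\<^esub> (x \<oplus>\<^bsub>V\<^esub> y)"
    and "a \<in> carrier K \<Longrightarrow> x \<in> carrier V \<Longrightarrow>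
      a \<odot>\<^bsub>quotient_vs V N\<^esub> (N +>\<^bsub>V\<^esub> x) = N +>\<^bsub>V\<^esub> (a \<odot>\<^bsub>V\<^esub> x)"
proof -
  interpret N: submodule K N V by (rule sub)
  show "carrier (quotient_vs V N) = (\<lambda>x. N +>\<^bsub>V\<^esub> x) ` carrier V"
    by (auto simp: quotient_vs_def A_RCOSETS_def')
  show "\<zero>\<^bsub>quotient_vs V N\<^esub> = N +>\<^bsub>V\<^esub> \<zero>\<^bsub>V\<^esub>"
    using V.M.a_coset_add_zero[OF A.a_subset] by (simp add: quotient_vs_def)
  show "(N +>\<^bsub>V\<^esub> x) \<oplus>\<^bsub>quotient_vs V N\<^esub> (N +>\<^bsub>V\<^esub> y) = N +>\<^bsub>V\<^esub> (x \<oplus>\<^bsub>V\<^esub> y)"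
    if "x \<in> carrier V" "y \<in> carrier V"
    using A.a_rcos_sum that by (simp add: quotient_vs_def)
  show "a \<odot>\<^bsub>quotient_vs V N\<^esub> (N +>\<^bsub>V\<^esub> x) = N +>\<^bsub>V\<^esub> (a \<odot>\<^bsub>V\<^esub> x)"
    if a: "a \<in> carrier K" and x: "x \<in> carrier V"
  proof -
    have *: "N +>\<^bsub>V\<^esub> (a \<odot>\<^bsub>V\<^esub> y) = N +>\<^bsub>V\<^esub> (a \<odot>\<^bsub>V\<^esub> x)" if y: "y \<in> N +>\<^bsub>V\<^esub> x" for y
    proof -
      obtain n where n: "n \<in> N" "y = n \<oplus>\<^bsub>V\<^esub> x" using y by (auto simp: a_r_coset_def')
      have nV: "n \<in> carrier V" using n A.a_subset by auto
      have "a \<odot>\<^bsub>V\<^esub> y = a \<odot>\<^bsub>V\<^esub> n \<oplus>\<^bsub>V\<^esub> a \<odot>\<^bsub>V\<^esub> x"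
        using n nV a x by (simp add: V.smult_r_distr)
      moreover have "a \<odot>\<^bsub>V\<^esub> n \<in> N" using a n by simp
      ultimately have "a \<odot>\<^bsub>V\<^esub> y \<in> N +>\<^bsub>V\<^esub> (a \<odot>\<^bsub>V\<^esub> x)" by (auto simp: a_r_coset_def')
      then show ?thesis
        using V.M.a_repr_independence[OF _ _ A.a_subgroup] a x by simp
    qed
    have "x \<in> N +>\<^bsub>V\<^esub> x" by (rule A.a_rcos_self[OF x])
    then have "(\<Union>y\<in>N +>\<^bsub>V\<^esub> x. N +>\<^bsub>V\<^esub> (a \<odot>\<^bsub>V\<^esub> y)) = N +>\<^bsub>V\<^esub> (a \<odot>\<^bsub>V\<^esub> x)"
      using * by blast
    then show ?thesis by (simp add: quotient_vs_def)
  qed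
qed

lemma module_quotient_vs: "module K (quotient_vs V N)"
proof (rule module_criteria)
  let ?Q = "quotient_vs V N"
  let ?p = "\<lambda>x. N +>\<^bsub>V\<^esub> x"
  have car: "\<exists>x\<in>carrier V. v = ?p x" if "v \<in> carrier ?Q" for v
    using that by (auto simp: quotient_sel(1))
  have p: "?p x \<in> carrier ?Q" if "x \<in> carrier V" for x
    using that by (auto simp: quotient_sel(1))
  show "cring K" by (rule V.R.is_cring)
  show "\<zero>\<^bsub>?Q\<^esub> \<in> carrier ?Q"
    unfolding quotient_sel(2) by (rule p) simp
  show "\<forall>v w. v \<in> carrier ?Q \<and> w \<in> carrier ?Q \<longrightarrow> v \<oplus>\<^bsub>?Q\<^esub> w \<in> carrier ?Q"
    using car p quotient_sel(3) V.M.a_closed by metis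
  show "\<forall>v\<in>carrier ?Q. \<exists>neg_v\<in>carrier ?Q. v \<oplus>\<^bsub>?Q\<^esub> neg_v = \<zero>\<^bsub>?Q\<^esub>"
    using car p quotient_sel(2,3) V.M.a_inv_closed V.M.r_neg by metis
  show "\<forall>c v. c \<in> carrier K \<and> v \<in> carrier ?Q \<longrightarrow> c \<odot>\<^bsub>?Q\<^esub> v \<in> carrier ?Q"
    using car p quotient_sel(4) V.smult_closed by metis
  show "\<forall>v w. v \<in> carrier ?Q \<and> w \<in> carrier ?Q \<longrightarrow> v \<oplus>\<^bsub>?Q\<^esub> w = w \<oplus>\<^bsub>?Q\<^esub> v"
    using car quotient_sel(3) V.M.a_comm by metis
  show "\<forall>v w x. v \<in> carrier ?Q \<and> w \<in> carrier ?Q \<and> x \<in> carrier ?Q \<longrightarrow>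
      v \<oplus>\<^bsub>?Q\<^esub> w \<oplus>\<^bsub>?Q\<^esub> x = v \<oplus>\<^bsub>?Q\<^esub> (w \<oplus>\<^bsub>?Q\<^esub> x)"
  proof (intro allI impI; elim conjE)
    fix v w x assume "v \<in> carrier ?Q" "w \<in> carrier ?Q" "x \<in> carrier ?Q"
    then obtain v' w' x' where "v' \<in> carrier V" "w' \<in> carrier V" "x' \<in> carrier V"
      "v = ?p v'" "w = ?p w'" "x = ?p x'" using car by metis
    then show "v \<oplus>\<^bsub>?Q\<^esub> w \<oplus>\<^bsub>?Q\<^esub> x = v \<oplus>\<^bsub>?Q\<^esub> (w \<oplus>\<^bsub>?Q\<^esub> x)"
      by (simp only: quotient_sel(3) V.M.a_closed V.M.a_assoc)
  qed
  show "\<forall>v\<in>carrier ?Q. v \<oplus>\<^bsub>?Q\<^esub> \<zero>\<^bsub>?Q\<^esub> = v"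
    using car quotient_sel(2,3) V.M.zero_closed V.M.r_zero by metis
  show "\<forall>a b v. a \<in> carrier K \<and> b \<in> carrier K \<and> v \<in> carrier ?Q \<longrightarrow>
      (a \<otimes> b) \<odot>\<^bsub>?Q\<^esub> v = a \<odot>\<^bsub>?Q\<^esub> (b \<odot>\<^bsub>?Q\<^esub> v)"
  proof (intro allI impI; elim conjE)
    fix a b v assume "a \<in> carrier K" "b \<in> carrier K" "v \<in> carrier ?Q"
    moreover then obtain v' where "v' \<in> carrier V" "v = ?p v'" using car by metis
    ultimately show "(a \<otimes> b) \<odot>\<^bsub>?Q\<^esub> v = a \<odot>\<^bsub>?Q\<^esub> (b \<odot>\<^bsub>?Q\<^esub> v)"
      by (simp only: quotient_sel(4) V.smult_closed V.smult_assoc1 V.R.m_closed)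
  qed
  show "\<forall>v\<in>carrier ?Q. \<one> \<odot>\<^bsub>?Q\<^esub> v = v"
    using car quotient_sel(4) V.smult_one V.R.one_closed by metis
  show "\<forall>a b v. a \<in> carrier K \<and> b \<in> carrier K \<and> v \<in> carrier ?Q \<longrightarrow>
      (a \<oplus> b) \<odot>\<^bsub>?Q\<^esub> v = a \<odot>\<^bsub>?Q\<^esub> v \<oplus>\<^bsub>?Q\<^esub> b \<odot>\<^bsub>?Q\<^esub> v"
  proof (intro allI impI; elim conjE)
    fix a b v assume "a \<in> carrier K" "b \<in> carrier K" "v \<in> carrier ?Q"
    moreover then obtain v' where "v' \<in> carrier V" "v = ?p v'" using car by metis
    ultimately show "(a \<oplus> b) \<odot>\<^bsub>?Q\<^esub> v = a \<odot>\<^bsub>?Q\<^esub> v \<oplus>\<^bsub>?Q\<^esub> b \<odot>\<^bsub>?Q\<^esub> v"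
      by (simp only: quotient_sel(3,4) V.smult_closed V.smult_l_distr V.R.a_closed)
  qed
  show "\<forall>a v w. a \<in> carrier K \<and> v \<in> carrier ?Q \<and> w \<in> carrier ?Q \<longrightarrow>
      a \<odot>\<^bsub>?Q\<^esub> (v \<oplus>\<^bsub>?Q\<^esub> w) = a \<odot>\<^bsub>?Q\<^esub> v \<oplus>\<^bsub>?Q\<^esub> a \<odot>\<^bsub>?Q\<^esub> w"
  proof (intro allI impI; elim conjE)
    fix a v w assume "a \<in> carrier K" "v \<in> carrier ?Q" "w \<in> carrier ?Q"
    moreover then obtain v' w' where "v' \<in> carrier V" "v = ?p v'" "w' \<in> carrier V" "w = ?p w'"
      using car by metis
    ultimately show "a \<odot>\<^bsub>?Q\<^esub> (v \<oplus>\<^bsub>?Q\<^esub> w) = a \<odot>\<^bsub>?Q\<^esub> v \<oplus>\<^bsub>?Q\<^esub> a \<odot>\<^bsub>?Q\<^esub> w"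
      by (simp only: quotient_sel(3,4) V.smult_closed V.smult_r_distr V.M.a_closed)
  qed
qed

lemma quotient_proj_hom: "(\<lambda>x. N +>\<^bsub>V\<^esub> x) \<in> module_hom K V (quotient_vs V N)"
  by (rule module_homI) (simp_all add: quotient_sel(1,3,4))

lemma quotient_descend:
  assumes X: "module K X" and h: "h \<in> module_hom K V X" and ker: "\<And>n. n \<in> N \<Longrightarrow> h n = \<zero>\<^bsub>X\<^esub>"
  obtains g where "g \<in> module_hom K (quotient_vs V N) X"
    "\<And>x. x \<in> carrier V \<Longrightarrow> g (N +>\<^bsub>V\<^esub> x) = h x"
proof -
  interpret X: module K X by fact
  interpret H: mod_hom K V X h
    by (intro mod_hom.intro mod_hom_axioms.intro X h V.module_axioms)
  define g where "g Y = h (SOME y. y \<in> Y)" for Y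
  have g: "g (N +>\<^bsub>V\<^esub> x) = h x" if x: "x \<in> carrier V" for x
  proof -
    have "(SOME y. y \<in> N +>\<^bsub>V\<^esub> x) \<in> N +>\<^bsub>V\<^esub> x"
      using A.a_rcos_self[OF x] by (rule someI)
    then obtain n where n: "n \<in> N" "(SOME y. y \<in> N +>\<^bsub>V\<^esub> x) = n \<oplus>\<^bsub>V\<^esub> x"
      by (auto simp: a_r_coset_def')
    moreover have "n \<in> carrier V" using n A.a_subset by auto
    ultimately show ?thesis using x ker[OF n(1)] by (simp add: g_def)
  qed
  have "g \<in> module_hom K (quotient_vs V N) X"
    by (rule module_homI) (auto simp add: quotient_sel(1,3,4) g module_hom_mem[OF h])
  then show ?thesis using g by (rule that)
qed

end

lemma tensor_relations_subset:
  fixes K (structure)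
  assumes V: "module K V" and W: "module K W"
  shows "tensor_relations K V W \<subseteq> carrier (free_vs K (carrier V \<times> carrier W))"
proof -
  interpret V: module K V by fact
  interpret W: module K W by fact
  have K: "cring K" by (rule V.R.is_cring)
  interpret F: module K "free_vs K (carrier V \<times> carrier W)" by (rule module_free_vs[OF K])
  have e: "free_gen K (carrier V \<times> carrier W) (v, w) \<in> carrier (free_vs K (carrier V \<times> carrier W))"
    if "v \<in> carrier V" "w \<in> carrier W" for v w
    by (rule free_gen_closed[OF K]) (use that in simp)
  show ?thesis
    unfolding tensor_relations_def Let_def
    by (intro Un_least; rule subsetI; elim CollectE exE conjE; simp only:;
        intro F.M.minus_closed F.M.a_closed F.smult_closed e V.M.a_closed W.M.a_closed
          V.smult_closed W.smult_closed)
qed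

lemma submodule_tensor_null:
  fixes K (structure)
  assumes V: "module K V" and W: "module K W"
  shows "submodule K (tensor_null K V W) (free_vs K (carrier V \<times> carrier W))"
proof -
  interpret V: module K V by fact
  interpret F: module K "free_vs K (carrier V \<times> carrier W)"
    by (rule module_free_vs[OF V.R.is_cring])
  show ?thesis unfolding tensor_null_def
    by (rule F.span_is_submodule[OF tensor_relations_subset[OF V W]])
qed

lemma module_tensor:
  assumes "module K V" "module K W"
  shows "module K (tensor K V W)"
  unfolding tensor_def by (rule module_quotient_vs[OF submodule_tensor_null[OF assms]])

lemma bilinear_pure_tensor:
  fixes K (structure)
  assumes V: "module K V" and W: "module K W"
  shows "bilinear_map K V W (tensor K V W) (pure_tensor K V W)"
proof -
  interpret V: module K V by fact
  interpret W: module K W by fact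
  let ?F = "free_vs K (carrier V \<times> carrier W)"
  let ?e = "free_gen K (carrier V \<times> carrier W)"
  let ?N = "tensor_null K V W"
  have K: "cring K" by (rule V.R.is_cring)
  interpret F: module K ?F by (rule module_free_vs[OF K])
  note sub = submodule_tensor_null[OF V W]
  interpret A: abelian_subgroup ?N ?F by (rule quotient_abelian_subgroup[OF sub])
  note Q = quotient_sel[OF sub]
  have e: "?e (v, w) \<in> carrier ?F" if "v \<in> carrier V" "w \<in> carrier W" for v w
    by (rule free_gen_closed[OF K]) (use that in simp)
  have rel: "tensor_relations K V W \<subseteq> ?N"
    unfolding tensor_null_def by (rule F.in_own_span[OF tensor_relations_subset[OF V W]])
  have eq: "?N +>\<^bsub>?F\<^esub> x = ?N +>\<^bsub>?F\<^esub> y"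
    if "x \<in> carrier ?F" "y \<in> carrier ?F" "x \<ominus>\<^bsub>?F\<^esub> y \<in> tensor_relations K V W" for x y
  proof -
    have "x \<in> ?N +>\<^bsub>?F\<^esub> y"
      using A.a_rcos_module_rev that rel by (auto simp: a_minus_def)
    then show ?thesis
      using F.M.a_repr_independence[OF _ that(2) A.a_subgroup] by simp
  qed
  show ?thesis
    unfolding bilinear_map_def
  proof (intro conjI ballI module_homI, goal_cases)
    case (1 v w)
    then show ?case unfolding pure_tensor_def tensor_def Q using e by blast
  next
    case (2 v w w')
    have "?N +>\<^bsub>?F\<^esub> ?e (v, w \<oplus>\<^bsub>W\<^esub> w') = ?N +>\<^bsub>?F\<^esub> (?e (v, w) \<oplus>\<^bsub>?F\<^esub> ?e (v, w'))"
      by (insert 2, intro eq; (intro F.M.a_closed F.smult_closed e V.M.a_closed W.M.a_closed V.smult_closed W.smult_closed; assumption)?)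
         (unfold tensor_relations_def Let_def, rule UnI1, rule UnI1, rule UnI2, rule CollectI, (rule exI)+,
          intro conjI, rule refl, assumption+)
    then show ?case unfolding pure_tensor_def tensor_def using 2 e Q(3) by metis
  next
    case (3 v a w)
    have "?N +>\<^bsub>?F\<^esub> ?e (v, a \<odot>\<^bsub>W\<^esub> w) = ?N +>\<^bsub>?F\<^esub> (a \<odot>\<^bsub>?F\<^esub> ?e (v, w))"
      by (insert 3, intro eq; (intro F.M.a_closed F.smult_closed e V.M.a_closed W.M.a_closed V.smult_closed W.smult_closed; assumption)?)
         (unfold tensor_relations_def Let_def, rule UnI2, rule CollectI, (rule exI)+,
          intro conjI, rule refl, assumption+)
    then show ?case unfolding pure_tensor_def tensor_def using 3 e Q(4) by metis
  next
    case (4 w v)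
    then show ?case unfolding pure_tensor_def tensor_def Q using e by blast
  next
    case (5 w v v')
    have "?N +>\<^bsub>?F\<^esub> ?e (v \<oplus>\<^bsub>V\<^esub> v', w) = ?N +>\<^bsub>?F\<^esub> (?e (v, w) \<oplus>\<^bsub>?F\<^esub> ?e (v', w))"
      by (insert 5, intro eq; (intro F.M.a_closed F.smult_closed e V.M.a_closed W.M.a_closed V.smult_closed W.smult_closed; assumption)?)
         (unfold tensor_relations_def Let_def, rule UnI1, rule UnI1, rule UnI1, rule CollectI, (rule exI)+,
          intro conjI, rule refl, assumption+)
    then show ?case unfolding pure_tensor_def tensor_def using 5 e Q(3) by metis
  next
    case (6 w a v)
    have "?N +>\<^bsub>?F\<^esub> ?e (a \<odot>\<^bsub>V\<^esub> v, w) = ?N +>\<^bsub>?F\<^esub> (a \<odot>\<^bsub>?F\<^esub> ?e (v, w))"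
      by (insert 6, intro eq; (intro F.M.a_closed F.smult_closed e V.M.a_closed W.M.a_closed V.smult_closed W.smult_closed; assumption)?)
         (unfold tensor_relations_def Let_def, rule UnI1, rule UnI2, rule CollectI, (rule exI)+,
          intro conjI, rule refl, assumption+)
    then show ?case unfolding pure_tensor_def tensor_def using 6 e Q(4) by metis
  qed
qed

lemma pure_tensor_closed:
  assumes "module K V" "module K W" "v \<in> carrier V" "w \<in> carrier W"
  shows "pure_tensor K V W v w \<in> carrier (tensor K V W)"
proof -
  have "pure_tensor K V W v \<in> module_hom K W (tensor K V W)"
    using bilinear_pure_tensor[OF assms(1,2)] assms(3) by (simp add: bilinear_map_def)
  from module_hom_mem[OF this assms(4)] show ?thesis .
qed

lemma tensor_hom_ext:
  assumes V: "module K V" and W: "module K W" and X: "module K X"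
    and h: "h \<in> module_hom K (tensor K V W) X" and h': "h' \<in> module_hom K (tensor K V W) X"
    and eq: "\<And>v w. v \<in> carrier V \<Longrightarrow> w \<in> carrier W \<Longrightarrow>
      h (pure_tensor K V W v w) = h' (pure_tensor K V W v w)"
    and t: "t \<in> carrier (tensor K V W)"
  shows "h t = h' t"
proof -
  let ?F = "free_vs K (carrier V \<times> carrier W)"
  let ?p = "\<lambda>x. tensor_null K V W +>\<^bsub>?F\<^esub> x"
  note sub = submodule_tensor_null[OF V W]
  have K: "cring K" by (rule module.axioms(1)[OF V])
  have p: "?p \<in> module_hom K ?F (tensor K V W)"
    unfolding tensor_def by (rule quotient_proj_hom[OF sub])
  obtain x where x: "x \<in> carrier ?F" "t = ?p x"
    using t unfolding tensor_def quotient_sel[OF sub] by blast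
  have "(\<lambda>x. h (?p x)) x = (\<lambda>x. h' (?p x)) x"
    by (rule module_hom_ext_free[OF K X module_hom_comp[OF p h] module_hom_comp[OF p h'] _ x(1)])
       (use eq in \<open>auto simp: pure_tensor_def\<close>)
  then show ?thesis using x by simp
qed

lemma tensor_universal:
  fixes K (structure)
  assumes V: "module K V" and W: "module K W" and X: "module K X"
    and b: "bilinear_map K V W X \<beta>"
  shows "\<exists>!h. h \<in> module_hom K (tensor K V W) X \<and> h \<in> extensional (carrier (tensor K V W)) \<and>
    (\<forall>v\<in>carrier V. \<forall>w\<in>carrier W. h (pure_tensor K V W v w) = \<beta> v w)"
proof (rule ex_ex1I)
  interpret V: module K V by fact
  interpret W: module K W by fact
  interpret X: module K X by fact
  let ?F = "free_vs K (carrier V \<times> carrier W)"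
  let ?e = "free_gen K (carrier V \<times> carrier W)"
  let ?N = "tensor_null K V W"
  have K: "cring K" by (rule V.R.is_cring)
  interpret F: module K ?F by (rule module_free_vs[OF K])
  note sub = submodule_tensor_null[OF V W]
  have b1: "\<beta> v \<in> module_hom K W X" if "v \<in> carrier V" for v
    using b that by (auto simp: bilinear_map_def)
  have b2: "(\<lambda>v. \<beta> v w) \<in> module_hom K V X" if "w \<in> carrier W" for w
    using b that by (auto simp: bilinear_map_def)
  have bm: "\<beta> v w \<in> carrier X" if "v \<in> carrier V" "w \<in> carrier W" for v w
    using module_hom_mem[OF b1] that by blast
  obtain h where h: "h \<in> module_hom K ?F X"
    and he: "\<And>s. s \<in> carrier V \<times> carrier W \<Longrightarrow> h (?e s) = case_prod \<beta> s"
    using free_lift_exists[OF K X, of "carrier V \<times> carrier W" "case_prod \<beta>"] bm by auto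
  have he: "h (?e (v, w)) = \<beta> v w" if "v \<in> carrier V" "w \<in> carrier W" for v w
    using he that by auto
  interpret H: mod_hom K ?F X h
    by (intro mod_hom.intro mod_hom_axioms.intro X h F.module_axioms)
  have e: "?e (v, w) \<in> carrier ?F" if "v \<in> carrier V" "w \<in> carrier W" for v w
    by (rule free_gen_closed[OF K]) (use that in simp)
  have ker: "x \<ominus>\<^bsub>?F\<^esub> y \<in> H.ker" if "x \<in> carrier ?F" "y \<in> carrier ?F" "h x = h y" for x y
    unfolding H.ker_def mem_Collect_eq
    using that H.f_minus[OF that(1,2)] by (metis F.M.minus_closed H.f_im X.M.minus_other_side)
  have "tensor_relations K V W \<subseteq> H.ker"
    unfolding tensor_relations_def Let_def
  proof ((intro Un_least; rule subsetI; elim CollectE exE conjE; simp only:; rule ker), goal_cases)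
    case (3 x v v' w)
    then show ?case
      using module_hom_add[OF b2, of w v v'] 3 by (simp only: H.f_add e he V.M.a_closed)
  next
    case (6 x v w w')
    then show ?case
      using module_hom_add[OF b1, of v w w'] 6 by (simp only: H.f_add e he W.M.a_closed)
  next
    case (9 x a v w)
    then show ?case
      using module_hom_smult[OF b2, of w a v] 9 by (simp only: H.f_smult e he V.smult_closed)
  next
    case (12 x a v w)
    then show ?case
      using module_hom_smult[OF b1, of v a w] 12 by (simp only: H.f_smult e he W.smult_closed)
  qed (intro F.M.a_closed F.smult_closed e V.M.a_closed W.M.a_closed V.smult_closed W.smult_closed; assumption)+
  then have "?N \<subseteq> H.ker"
    unfolding tensor_null_def by (rule F.span_is_subset[OF _ H.ker_is_submodule])
  then have "\<And>n. n \<in> ?N \<Longrightarrow> h n = \<zero>\<^bsub>X\<^esub>" by (auto simp: H.ker_def)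
  from quotient_descend[OF sub X h this] obtain g where
    g: "g \<in> module_hom K (quotient_vs ?F ?N) X" "\<And>x. x \<in> carrier ?F \<Longrightarrow> g (?N +>\<^bsub>?F\<^esub> x) = h x"
    by blast
  have T: "module K (tensor K V W)" by (rule module_tensor[OF V W])
  note pt = pure_tensor_closed[OF V W]
  let ?g = "restrict g (carrier (tensor K V W))"
  have "?g \<in> module_hom K (tensor K V W) X"
    by (rule module_hom_restrict[OF T]) (use g(1) in \<open>simp add: tensor_def\<close>)
  moreover have "?g (pure_tensor K V W v w) = \<beta> v w" if "v \<in> carrier V" "w \<in> carrier W" for v w
  proof -
    have "?g (pure_tensor K V W v w) = g (pure_tensor K V W v w)" using pt[OF that] by simp
    also have "\<dots> = h (?e (v, w))" unfolding pure_tensor_def by (rule g(2)[OF e[OF that]])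
    finally show ?thesis using he[OF that] by simp
  qed
  ultimately show "\<exists>h. h \<in> module_hom K (tensor K V W) X \<and>
      h \<in> extensional (carrier (tensor K V W)) \<and>
      (\<forall>v\<in>carrier V. \<forall>w\<in>carrier W. h (pure_tensor K V W v w) = \<beta> v w)"
    by (intro exI[of _ ?g]) auto
next
  fix h h'
  assume "h \<in> module_hom K (tensor K V W) X \<and> h \<in> extensional (carrier (tensor K V W)) \<and>
      (\<forall>v\<in>carrier V. \<forall>w\<in>carrier W. h (pure_tensor K V W v w) = \<beta> v w)"
    "h' \<in> module_hom K (tensor K V W) X \<and> h' \<in> extensional (carrier (tensor K V W)) \<and>
      (\<forall>v\<in>carrier V. \<forall>w\<in>carrier W. h' (pure_tensor K V W v w) = \<beta> v w)"
  then show "h = h'"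
    using tensor_hom_ext[OF V W X, of h h'] by (intro extensionalityI) auto
qed

lemma
  assumes "module K V" "module K W" "module K X" "bilinear_map K V W X \<beta>"
  shows tensor_lift_hom: "tensor_lift K V W X \<beta> \<in> module_hom K (tensor K V W) X"
    and tensor_lift_pure: "v \<in> carrier V \<Longrightarrow> w \<in> carrier W \<Longrightarrow>
      tensor_lift K V W X \<beta> (pure_tensor K V W v w) = \<beta> v w"
  using theI'[OF tensor_universal[OF assms]] unfolding tensor_lift_def by simp_all

section \<open>Canonical maps\<close>

definition base_field :: "('k, 'm) ring_scheme \<Rightarrow> ('k, 'k) module" where
  "base_field K = \<lparr>carrier = carrier K, mult = mult K, one = \<one>\<^bsub>K\<^esub>, zero = \<zero>\<^bsub>K\<^esub>,
     add = add K, smult = mult K\<rparr>"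

definition tensor_map ::
  "('k, 'm) ring_scheme \<Rightarrow> ('k, 'v, 'n) module_scheme \<Rightarrow> ('k, 'w, 'p) module_scheme \<Rightarrow>
   ('k, 'v2, 'n2) module_scheme \<Rightarrow> ('k, 'w2, 'p2) module_scheme \<Rightarrow>
   ('v \<Rightarrow> 'v2) \<Rightarrow> ('w \<Rightarrow> 'w2) \<Rightarrow> ('v \<times> 'w \<Rightarrow> 'k) set \<Rightarrow> ('v2 \<times> 'w2 \<Rightarrow> 'k) set" where
  "tensor_map K V W V' W' f g =
     tensor_lift K V W (tensor K V' W') (\<lambda>v w. pure_tensor K V' W' (f v) (g w))"

definition tensor_flip ::
  "('k, 'm) ring_scheme \<Rightarrow> ('k, 'v, 'n) module_scheme \<Rightarrow> ('k, 'w, 'p) module_scheme \<Rightarrow>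
   ('v \<times> 'w \<Rightarrow> 'k) set \<Rightarrow> ('w \<times> 'v \<Rightarrow> 'k) set" where
  "tensor_flip K V W = tensor_lift K V W (tensor K W V) (\<lambda>v w. pure_tensor K W V w v)"

text \<open>\<open>(U \<otimes> V) \<otimes> W \<rightarrow> U \<otimes> (V \<otimes> W)\<close>\<close>

definition tensor_assoc ::
  "('k, 'm) ring_scheme \<Rightarrow> ('k, 'u, 'q) module_scheme \<Rightarrow> ('k, 'v, 'n) module_scheme \<Rightarrow>
   ('k, 'w, 'p) module_scheme \<Rightarrow>
   (('u \<times> 'v \<Rightarrow> 'k) set \<times> 'w \<Rightarrow> 'k) set \<Rightarrow> ('u \<times> ('v \<times> 'w \<Rightarrow> 'k) set \<Rightarrow> 'k) set" where
  "tensor_assoc K U V W =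
     tensor_lift K (tensor K U V) W (tensor K U (tensor K V W))
       (\<lambda>t w. tensor_lift K U V (tensor K U (tensor K V W))
          (\<lambda>u v. pure_tensor K U (tensor K V W) u (pure_tensor K V W v w)) t)"

text \<open>\<open>U \<otimes> (V \<otimes> W) \<rightarrow> (U \<otimes> V) \<otimes> W\<close>\<close>

definition tensor_unassoc ::
  "('k, 'm) ring_scheme \<Rightarrow> ('k, 'u, 'q) module_scheme \<Rightarrow> ('k, 'v, 'n) module_scheme \<Rightarrow>
   ('k, 'w, 'p) module_scheme \<Rightarrow>
   ('u \<times> ('v \<times> 'w \<Rightarrow> 'k) set \<Rightarrow> 'k) set \<Rightarrow> (('u \<times> 'v \<Rightarrow> 'k) set \<times> 'w \<Rightarrow> 'k) set" where
  "tensor_unassoc K U V W =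
     tensor_lift K U (tensor K V W) (tensor K (tensor K U V) W)
       (\<lambda>u t. tensor_lift K V W (tensor K (tensor K U V) W)
          (\<lambda>v w. pure_tensor K (tensor K U V) W (pure_tensor K U V u v) w) t)"

text \<open>The identifications \<open>k \<otimes> V = V\<close> and \<open>V \<otimes> k = V\<close>.\<close>

definition tensor_lunit ::
  "('k, 'm) ring_scheme \<Rightarrow> ('k, 'v, 'n) module_scheme \<Rightarrow> ('k \<times> 'v \<Rightarrow> 'k) set \<Rightarrow> 'v" where
  "tensor_lunit K V = tensor_lift K (base_field K) V V (\<lambda>a v. a \<odot>\<^bsub>V\<^esub> v)"

definition tensor_runit ::
  "('k, 'm) ring_scheme \<Rightarrow> ('k, 'v, 'n) module_scheme \<Rightarrow> ('v \<times> 'k \<Rightarrow> 'k) set \<Rightarrow> 'v" where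
  "tensor_runit K V = tensor_lift K V (base_field K) V (\<lambda>v a. a \<odot>\<^bsub>V\<^esub> v)"

section \<open>Coalgebras and bicomodules\<close>

locale coalgebra = C: vectorspace K C
  for K :: "('k, 'm) ring_scheme" and C :: "('k, 'c, 'n) module_scheme" +
  fixes \<Delta> :: "'c \<Rightarrow> ('c \<times> 'c \<Rightarrow> 'k) set" and \<epsilon> :: "'c \<Rightarrow> 'k"
  assumes comult_hom: "\<Delta> \<in> module_hom K C (tensor K C C)"
    and counit_hom: "\<epsilon> \<in> module_hom K C (base_field K)"
    and coassoc: "\<And>c. c \<in> carrier C \<Longrightarrow>
      tensor_assoc K C C C (tensor_map K C C (tensor K C C) C \<Delta> (\<lambda>x. x) (\<Delta> c)) =
      tensor_map K C C C (tensor K C C) (\<lambda>x. x) \<Delta> (\<Delta> c)"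
    and counit_left: "\<And>c. c \<in> carrier C \<Longrightarrow>
      tensor_lunit K C (tensor_map K C C (base_field K) C \<epsilon> (\<lambda>x. x) (\<Delta> c)) = c"
    and counit_right: "\<And>c. c \<in> carrier C \<Longrightarrow>
      tensor_runit K C (tensor_map K C C C (base_field K) (\<lambda>x. x) \<epsilon> (\<Delta> c)) = c"

locale left_comodule = D: coalgebra K D \<Delta> \<epsilon> + M: vectorspace K M
  for K :: "('k, 'm) ring_scheme" and D :: "('k, 'd, 'n) module_scheme" and \<Delta> \<epsilon>
    and M :: "('k, 'v, 'p) module_scheme" +
  fixes lM :: "'v \<Rightarrow> ('d \<times> 'v \<Rightarrow> 'k) set"
  assumes lcoact_hom: "lM \<in> module_hom K M (tensor K D M)"
    and lcoact_coassoc: "\<And>m. m \<in> carrier M \<Longrightarrow>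
      tensor_assoc K D D M (tensor_map K D M (tensor K D D) M \<Delta> (\<lambda>x. x) (lM m)) =
      tensor_map K D M D (tensor K D M) (\<lambda>x. x) lM (lM m)"
    and lcoact_counit: "\<And>m. m \<in> carrier M \<Longrightarrow>
      tensor_lunit K M (tensor_map K D M (base_field K) M \<epsilon> (\<lambda>x. x) (lM m)) = m"

locale right_comodule = C: coalgebra K C \<Delta> \<epsilon> + M: vectorspace K M
  for K :: "('k, 'm) ring_scheme" and C :: "('k, 'c, 'n) module_scheme" and \<Delta> \<epsilon>
    and M :: "('k, 'v, 'p) module_scheme" +
  fixes rM :: "'v \<Rightarrow> ('v \<times> 'c \<Rightarrow> 'k) set"
  assumes rcoact_hom: "rM \<in> module_hom K M (tensor K M C)"
    and rcoact_coassoc: "\<And>m. m \<in> carrier M \<Longrightarrow>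
      tensor_assoc K M C C (tensor_map K M C (tensor K M C) C rM (\<lambda>x. x) (rM m)) =
      tensor_map K M C M (tensor K C C) (\<lambda>x. x) \<Delta> (rM m)"
    and rcoact_counit: "\<And>m. m \<in> carrier M \<Longrightarrow>
      tensor_runit K M (tensor_map K M C M (base_field K) (\<lambda>x. x) \<epsilon> (rM m)) = m"

locale bicomodule = L: left_comodule K D \<Delta>D \<epsilon>D M lM + R: right_comodule K C \<Delta>C \<epsilon>C M rM
  for K :: "('k, 'm) ring_scheme" and D :: "('k, 'd, 'n) module_scheme" and \<Delta>D \<epsilon>D
    and C :: "('k, 'c, 'q) module_scheme" and \<Delta>C \<epsilon>C
    and M :: "('k, 'v, 'p) module_scheme" and lM rM +
  assumes coactions_commute: "\<And>m. m \<in> carrier M \<Longrightarrow>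
      tensor_assoc K D M C (tensor_map K M C (tensor K D M) C lM (\<lambda>x. x) (rM m)) =
      tensor_map K D M D (tensor K M C) (\<lambda>x. x) rM (lM m)"

text \<open>Morphisms of the category of left \<open>D\<close>- right \<open>C\<close>-comodules.\<close>

locale bicomodule_hom =
  M: bicomodule K D \<Delta>D \<epsilon>D C \<Delta>C \<epsilon>C M lM rM + N: bicomodule K D \<Delta>D \<epsilon>D C \<Delta>C \<epsilon>C N lN rN
  for K :: "('k, 'm) ring_scheme" and D :: "('k, 'd, 'n) module_scheme" and \<Delta>D \<epsilon>D
    and C :: "('k, 'c, 'q) module_scheme" and \<Delta>C \<epsilon>C
    and M :: "('k, 'v, 'p) module_scheme" and lM rM
    and N :: "('k, 'w, 'r) module_scheme" and lN rN +
  fixes f :: "'v \<Rightarrow> 'w"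
  assumes hom: "f \<in> module_hom K M N"
    and left_colinear: "\<And>m. m \<in> carrier M \<Longrightarrow>
      lN (f m) = tensor_map K D M D N (\<lambda>x. x) f (lM m)"
    and right_colinear: "\<And>m. m \<in> carrier M \<Longrightarrow>
      rN (f m) = tensor_map K M C N C f (\<lambda>x. x) (rM m)"

text \<open>The coactions on \<open>D \<otimes> C\<close>: \<open>\<Delta>D \<otimes> id\<close> and \<open>id \<otimes> \<Delta>C\<close>.\<close>

definition lcoact_DC where
  "lcoact_DC K D \<Delta>D C t =
     tensor_assoc K D D C (tensor_map K D C (tensor K D D) C \<Delta>D (\<lambda>x. x) t)"

definition rcoact_DC where
  "rcoact_DC K D C \<Delta>C t =
     tensor_unassoc K D C C (tensor_map K D C D (tensor K C C) (\<lambda>x. x) \<Delta>C t)"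

text \<open>The coactions on \<open>C \<otimes> D\<close>: \<open>c \<otimes> d \<mapsto> d\<^sub>1 \<otimes> (c \<otimes> d\<^sub>2)\<close> and
  \<open>c \<otimes> d \<mapsto> (c\<^sub>1 \<otimes> d) \<otimes> c\<^sub>2\<close>. A Sweedler expression bilinear in \<open>x\<^sub>1, x\<^sub>2\<close> is the induced linear
  map applied to the comultiplication of \<open>x\<close>.\<close>

definition lcoact_CD where
  "lcoact_CD K C D \<Delta>D =
     tensor_lift K C D (tensor K D (tensor K C D))
       (\<lambda>c d. tensor_lift K D D (tensor K D (tensor K C D))
          (\<lambda>d1 d2. pure_tensor K D (tensor K C D) d1 (pure_tensor K C D c d2)) (\<Delta>D d))"

definition rcoact_CD where
  "rcoact_CD K C \<Delta>C D =
     tensor_lift K C D (tensor K (tensor K C D) C)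
       (\<lambda>c d. tensor_lift K C C (tensor K (tensor K C D) C)
          (\<lambda>c1 c2. pure_tensor K (tensor K C D) C (pure_tensor K C D c1 d) c2) (\<Delta>C c))"

definition conormal where
  "conormal K C \<epsilon>C D \<epsilon>D \<Psi> \<longleftrightarrow>
     (\<forall>t\<in>carrier (tensor K C D).
        tensor_lunit K C (tensor_map K D C (base_field K) C \<epsilon>D (\<lambda>x. x) (\<Psi> t)) =
        tensor_runit K C (tensor_map K C D C (base_field K) (\<lambda>x. x) \<epsilon>D t)) \<and>
     (\<forall>t\<in>carrier (tensor K C D).
        tensor_runit K D (tensor_map K D C D (base_field K) (\<lambda>x. x) \<epsilon>C (\<Psi> t)) =
        tensor_lunit K D (tensor_map K C D (base_field K) D \<epsilon>C (\<lambda>x. x) t))"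

subsection \<open>Action of the canonical maps on pure tensors\<close>

lemma bilinear_mapI:
  assumes "\<And>v. v \<in> carrier V \<Longrightarrow> \<beta> v \<in> module_hom K W X"
    and "\<And>w. w \<in> carrier W \<Longrightarrow> (\<lambda>v. \<beta> v w) \<in> module_hom K V X"
  shows "bilinear_map K V W X \<beta>"
  using assms by (simp add: bilinear_map_def)

lemma
  assumes "module K V" "module K W"
  shows pure_hom_r: "v \<in> carrier V \<Longrightarrow> (\<lambda>w. pure_tensor K V W v w) \<in> module_hom K W (tensor K V W)"
    and pure_hom_l: "w \<in> carrier W \<Longrightarrow> (\<lambda>v. pure_tensor K V W v w) \<in> module_hom K V (tensor K V W)"
  using bilinear_pure_tensor[OF assms] by (simp_all add: bilinear_map_def)

lemma module_base_field:
  assumes "cring K"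
  shows "module K (base_field K)"
proof -
  interpret cring K by fact
  show ?thesis
    by (rule module_criteria)
       (auto simp: base_field_def is_cring add.m_ac m_assoc l_distr r_distr
         intro: bexI[of _ "\<ominus>\<^bsub>K\<^esub> _"] r_neg)
qed

lemma module_hom_add_hom:
  assumes N: "module K N" and f: "f \<in> module_hom K M N" and g: "g \<in> module_hom K M N"
  shows "(\<lambda>x. f x \<oplus>\<^bsub>N\<^esub> g x) \<in> module_hom K M N"
proof -
  interpret N: module K N by fact
  show ?thesis
    by (rule module_homI)
       (simp_all add: module_hom_mem[OF f] module_hom_mem[OF g] module_hom_add[OF f]
         module_hom_add[OF g] module_hom_smult[OF f] module_hom_smult[OF g]
         N.smult_r_distr N.M.add.m_ac)
qed

lemma module_hom_smult_hom:
  assumes N: "module K N" and a: "a \<in> carrier K" and f: "f \<in> module_hom K M N"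
  shows "(\<lambda>x. a \<odot>\<^bsub>N\<^esub> f x) \<in> module_hom K M N"
proof -
  interpret N: module K N by fact
  show ?thesis
  proof (rule module_homI)
    fix b x assume b: "b \<in> carrier K" and x: "x \<in> carrier M"
    have "a \<odot>\<^bsub>N\<^esub> (b \<odot>\<^bsub>N\<^esub> f x) = b \<odot>\<^bsub>N\<^esub> (a \<odot>\<^bsub>N\<^esub> f x)"
      using a b module_hom_mem[OF f x] N.R.m_comm by (simp flip: N.smult_assoc1)
    then show "a \<odot>\<^bsub>N\<^esub> f (b \<odot>\<^bsub>M\<^esub> x) = b \<odot>\<^bsub>N\<^esub> (a \<odot>\<^bsub>N\<^esub> f x)"
      using module_hom_smult[OF f b x] by simp
  qed (simp_all add: a module_hom_mem[OF f] module_hom_add[OF f] N.smult_r_distr)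
qed

lemma tensor_lift_param_hom:
  assumes U: "module K U" and V: "module K V" and W: "module K W" and X: "module K X"
    and b: "\<And>w. w \<in> carrier W \<Longrightarrow> bilinear_map K U V X (\<beta> w)"
    and c: "\<And>u v. u \<in> carrier U \<Longrightarrow> v \<in> carrier V \<Longrightarrow> (\<lambda>w. \<beta> w u v) \<in> module_hom K W X"
    and t: "t \<in> carrier (tensor K U V)"
  shows "(\<lambda>w. tensor_lift K U V X (\<beta> w) t) \<in> module_hom K W X"
proof -
  interpret W: module K W by fact
  note h = tensor_lift_hom[OF U V X b] and p = tensor_lift_pure[OF U V X b]
  show ?thesis
  proof (rule module_homI)
    fix w assume w: "w \<in> carrier W"
    show "tensor_lift K U V X (\<beta> w) t \<in> carrier X" by (rule module_hom_mem[OF h[OF w] t])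
  next
    fix w w' assume w: "w \<in> carrier W" and w': "w' \<in> carrier W"
    show "tensor_lift K U V X (\<beta> (w \<oplus>\<^bsub>W\<^esub> w')) t =
        tensor_lift K U V X (\<beta> w) t \<oplus>\<^bsub>X\<^esub> tensor_lift K U V X (\<beta> w') t"
      by (rule tensor_hom_ext[OF U V X h[OF W.M.a_closed[OF w w']]
              module_hom_add_hom[OF X h[OF w] h[OF w']] _ t])
         (simp add: p w w' module_hom_add[OF c w w'])
  next
    fix a w assume a: "a \<in> carrier K" and w: "w \<in> carrier W"
    show "tensor_lift K U V X (\<beta> (a \<odot>\<^bsub>W\<^esub> w)) t = a \<odot>\<^bsub>X\<^esub> tensor_lift K U V X (\<beta> w) t"
      by (rule tensor_hom_ext[OF U V X h[OF W.smult_closed[OF a w]]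
              module_hom_smult_hom[OF X a h[OF w]] _ t])
         (simp add: p a w module_hom_smult[OF c a w])
  qed
qed

lemma
  assumes m: "module K V" "module K W" "module K V'" "module K W'"
    and f: "f \<in> module_hom K V V'" and g: "g \<in> module_hom K W W'"
  shows tensor_map_hom: "tensor_map K V W V' W' f g \<in> module_hom K (tensor K V W) (tensor K V' W')"
    and tensor_map_pure: "v \<in> carrier V \<Longrightarrow> w \<in> carrier W \<Longrightarrow>
      tensor_map K V W V' W' f g (pure_tensor K V W v w) = pure_tensor K V' W' (f v) (g w)"
proof -
  have b: "bilinear_map K V W (tensor K V' W') (\<lambda>v w. pure_tensor K V' W' (f v) (g w))"
  proof (rule bilinear_mapI)
    fix v assume v: "v \<in> carrier V"
    show "(\<lambda>w. pure_tensor K V' W' (f v) (g w)) \<in> module_hom K W (tensor K V' W')"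
      by (rule module_hom_comp[OF g pure_hom_r[OF m(3,4) module_hom_mem[OF f v]]])
  next
    fix w assume w: "w \<in> carrier W"
    show "(\<lambda>v. pure_tensor K V' W' (f v) (g w)) \<in> module_hom K V (tensor K V' W')"
      by (rule module_hom_comp[OF f pure_hom_l[OF m(3,4) module_hom_mem[OF g w]]])
  qed
  note T = module_tensor[OF m(3,4)]
  show "tensor_map K V W V' W' f g \<in> module_hom K (tensor K V W) (tensor K V' W')"
    unfolding tensor_map_def by (rule tensor_lift_hom[OF m(1,2) T b])
  show "tensor_map K V W V' W' f g (pure_tensor K V W v w) = pure_tensor K V' W' (f v) (g w)"
    if "v \<in> carrier V" "w \<in> carrier W"
    unfolding tensor_map_def by (rule tensor_lift_pure[OF m(1,2) T b that])
qed

lemma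
  assumes m: "module K V" "module K W"
  shows tensor_flip_hom: "tensor_flip K V W \<in> module_hom K (tensor K V W) (tensor K W V)"
    and tensor_flip_pure: "v \<in> carrier V \<Longrightarrow> w \<in> carrier W \<Longrightarrow>
      tensor_flip K V W (pure_tensor K V W v w) = pure_tensor K W V w v"
proof -
  have b: "bilinear_map K V W (tensor K W V) (\<lambda>v w. pure_tensor K W V w v)"
    by (rule bilinear_mapI) (blast intro: pure_hom_l pure_hom_r m)+
  note T = module_tensor[OF m(2,1)]
  show "tensor_flip K V W \<in> module_hom K (tensor K V W) (tensor K W V)"
    unfolding tensor_flip_def by (rule tensor_lift_hom[OF m T b])
  show "tensor_flip K V W (pure_tensor K V W v w) = pure_tensor K W V w v"
    if "v \<in> carrier V" "w \<in> carrier W"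
    unfolding tensor_flip_def by (rule tensor_lift_pure[OF m T b that])
qed

lemma
  assumes m: "module K U" "module K V" "module K W"
  shows tensor_assoc_hom: "tensor_assoc K U V W \<in>
      module_hom K (tensor K (tensor K U V) W) (tensor K U (tensor K V W))"
    and tensor_assoc_pure: "u \<in> carrier U \<Longrightarrow> v \<in> carrier V \<Longrightarrow> w \<in> carrier W \<Longrightarrow>
      tensor_assoc K U V W (pure_tensor K (tensor K U V) W (pure_tensor K U V u v) w) =
      pure_tensor K U (tensor K V W) u (pure_tensor K V W v w)"
proof -
  let ?X = "tensor K U (tensor K V W)"
  let ?b = "\<lambda>w u v. pure_tensor K U (tensor K V W) u (pure_tensor K V W v w)"
  note UV = module_tensor[OF m(1,2)] and VW = module_tensor[OF m(2,3)]
  note X = module_tensor[OF m(1) VW]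
  have b: "bilinear_map K U V ?X (?b w)" if "w \<in> carrier W" for w
    by (rule bilinear_mapI)
       (blast intro: module_hom_comp[OF pure_hom_l[OF m(2,3) that] pure_hom_r[OF m(1) VW]]
          pure_hom_l[OF m(1) VW] pure_tensor_closed m that)+
  have b2: "bilinear_map K (tensor K U V) W ?X (\<lambda>t w. tensor_lift K U V ?X (?b w) t)"
  proof (rule bilinear_mapI)
    fix t assume t: "t \<in> carrier (tensor K U V)"
    show "(\<lambda>w. tensor_lift K U V ?X (?b w) t) \<in> module_hom K W ?X"
      by (rule tensor_lift_param_hom[OF m X b _ t], assumption)
         (rule module_hom_comp[OF pure_hom_r[OF m(2,3)] pure_hom_r[OF m(1) VW]])
  next
    fix w assume w: "w \<in> carrier W"
    show "(\<lambda>t. tensor_lift K U V ?X (?b w) t) \<in> module_hom K (tensor K U V) ?X"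
      by (rule tensor_lift_hom[OF m(1,2) X b[OF w]])
  qed
  show "tensor_assoc K U V W \<in> module_hom K (tensor K (tensor K U V) W) ?X"
    unfolding tensor_assoc_def by (rule tensor_lift_hom[OF UV m(3) X b2])
  show "tensor_assoc K U V W (pure_tensor K (tensor K U V) W (pure_tensor K U V u v) w) = ?b w u v"
    if "u \<in> carrier U" "v \<in> carrier V" "w \<in> carrier W"
    unfolding tensor_assoc_def using that
    by (simp add: tensor_lift_pure[OF UV m(3) X b2] tensor_lift_pure[OF m(1,2) X b]
        pure_tensor_closed m)
qed

lemma
  assumes m: "module K U" "module K V" "module K W"
  shows tensor_unassoc_hom: "tensor_unassoc K U V W \<in>
      module_hom K (tensor K U (tensor K V W)) (tensor K (tensor K U V) W)"
    and tensor_unassoc_pure: "u \<in> carrier U \<Longrightarrow> v \<in> carrier V \<Longrightarrow> w \<in> carrier W \<Longrightarrow>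
      tensor_unassoc K U V W (pure_tensor K U (tensor K V W) u (pure_tensor K V W v w)) =
      pure_tensor K (tensor K U V) W (pure_tensor K U V u v) w"
proof -
  let ?X = "tensor K (tensor K U V) W"
  let ?b = "\<lambda>u v w. pure_tensor K (tensor K U V) W (pure_tensor K U V u v) w"
  note UV = module_tensor[OF m(1,2)] and VW = module_tensor[OF m(2,3)]
  note X = module_tensor[OF UV m(3)]
  have b: "bilinear_map K V W ?X (?b u)" if "u \<in> carrier U" for u
    by (rule bilinear_mapI)
       (blast intro: module_hom_comp[OF pure_hom_r[OF m(1,2) that] pure_hom_l[OF UV m(3)]]
          pure_hom_r[OF UV m(3)] pure_tensor_closed m that)+
  have b2: "bilinear_map K U (tensor K V W) ?X (\<lambda>u t. tensor_lift K V W ?X (?b u) t)"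
  proof (rule bilinear_mapI)
    fix t assume t: "t \<in> carrier (tensor K V W)"
    show "(\<lambda>u. tensor_lift K V W ?X (?b u) t) \<in> module_hom K U ?X"
      by (rule tensor_lift_param_hom[OF m(2,3,1) X b _ t], assumption)
         (rule module_hom_comp[OF pure_hom_l[OF m(1,2)] pure_hom_l[OF UV m(3)]])
  next
    fix u assume u: "u \<in> carrier U"
    show "(\<lambda>t. tensor_lift K V W ?X (?b u) t) \<in> module_hom K (tensor K V W) ?X"
      by (rule tensor_lift_hom[OF m(2,3) X b[OF u]])
  qed
  show "tensor_unassoc K U V W \<in> module_hom K (tensor K U (tensor K V W)) ?X"
    unfolding tensor_unassoc_def by (rule tensor_lift_hom[OF m(1) VW X b2])
  show "tensor_unassoc K U V W (pure_tensor K U (tensor K V W) u (pure_tensor K V W v w)) = ?b u v w"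
    if "u \<in> carrier U" "v \<in> carrier V" "w \<in> carrier W"
    unfolding tensor_unassoc_def using that
    by (simp add: tensor_lift_pure[OF m(1) VW X b2] tensor_lift_pure[OF m(2,3) X b]
        pure_tensor_closed m)
qed

lemma base_field_sel [simp]:
  "carrier (base_field K) = carrier K" "a \<oplus>\<^bsub>base_field K\<^esub> b = a \<oplus>\<^bsub>K\<^esub> b"
  "a \<odot>\<^bsub>base_field K\<^esub> b = a \<otimes>\<^bsub>K\<^esub> b"
  by (simp_all add: base_field_def)

lemma
  assumes V: "module K V"
  shows tensor_lunit_hom: "tensor_lunit K V \<in> module_hom K (tensor K (base_field K) V) V"
    and tensor_lunit_pure: "a \<in> carrier K \<Longrightarrow> v \<in> carrier V \<Longrightarrow>
      tensor_lunit K V (pure_tensor K (base_field K) V a v) = a \<odot>\<^bsub>V\<^esub> v"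
    and tensor_runit_hom: "tensor_runit K V \<in> module_hom K (tensor K V (base_field K)) V"
    and tensor_runit_pure: "a \<in> carrier K \<Longrightarrow> v \<in> carrier V \<Longrightarrow>
      tensor_runit K V (pure_tensor K V (base_field K) v a) = a \<odot>\<^bsub>V\<^esub> v"
proof -
  interpret V: module K V by fact
  have B: "module K (base_field K)" by (rule module_base_field[OF V.R.is_cring])
  have 1: "(\<lambda>v. a \<odot>\<^bsub>V\<^esub> v) \<in> module_hom K V V" if "a \<in> carrier K" for a
    by (rule module_hom_smult_hom[OF V that module_hom_id])
  have 2: "(\<lambda>a. a \<odot>\<^bsub>V\<^esub> v) \<in> module_hom K (base_field K) V" if "v \<in> carrier V" for v
    by (rule module_homI) (use that in \<open>simp_all add: V.smult_l_distr V.smult_assoc1\<close>)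
  have b: "bilinear_map K (base_field K) V V (\<lambda>a v. a \<odot>\<^bsub>V\<^esub> v)"
    and c: "bilinear_map K V (base_field K) V (\<lambda>v a. a \<odot>\<^bsub>V\<^esub> v)"
    by (rule bilinear_mapI; simp add: 1 2)+
  show "tensor_lunit K V \<in> module_hom K (tensor K (base_field K) V) V"
    unfolding tensor_lunit_def by (rule tensor_lift_hom[OF B V V b])
  show "tensor_runit K V \<in> module_hom K (tensor K V (base_field K)) V"
    unfolding tensor_runit_def by (rule tensor_lift_hom[OF V B V c])
  show "tensor_lunit K V (pure_tensor K (base_field K) V a v) = a \<odot>\<^bsub>V\<^esub> v"
    if "a \<in> carrier K" "v \<in> carrier V"
    unfolding tensor_lunit_def using that by (simp add: tensor_lift_pure[OF B V V b])
  show "tensor_runit K V (pure_tensor K V (base_field K) v a) = a \<odot>\<^bsub>V\<^esub> v"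
    if "a \<in> carrier K" "v \<in> carrier V"
    unfolding tensor_runit_def using that by (simp add: tensor_lift_pure[OF V B V c])
qed

subsection \<open>The two tensor products are bicomodules\<close>

lemma vectorspaceI: "module K V \<Longrightarrow> field K \<Longrightarrow> vectorspace K V"
  by (rule vectorspace.intro)

lemma left_coaction_on_image:
  assumes "coalgebra K D \<Delta> \<epsilon>" and M: "module K M" and f: "f \<in> module_hom K D M"
    and l: "l \<in> module_hom K M (tensor K D M)"
    and lf: "\<And>d. d \<in> carrier D \<Longrightarrow> l (f d) = tensor_map K D D D M (\<lambda>x. x) f (\<Delta> d)"
    and d: "d \<in> carrier D"
  shows "tensor_assoc K D D M (tensor_map K D M (tensor K D D) M \<Delta> (\<lambda>x. x) (l (f d))) =
      tensor_map K D M D (tensor K D M) (\<lambda>x. x) l (l (f d))"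
    and "tensor_lunit K M (tensor_map K D M (base_field K) M \<epsilon> (\<lambda>x. x) (l (f d))) = f d"
proof -
  interpret C: coalgebra K D \<Delta> \<epsilon> by fact
  have D: "module K D" by (rule C.C.module_axioms)
  have B: "module K (base_field K)" by (rule module_base_field[OF C.C.R.is_cring])
  note DD = module_tensor[OF D D] and DM = module_tensor[OF D M]
  note D_DD = module_tensor[OF D DD] and D_DM = module_tensor[OF D DM]
  note Dh = C.comult_hom and eh = C.counit_hom and i = module_hom_id
  have Dd: "\<Delta> d \<in> carrier (tensor K D D)" by (rule module_hom_mem[OF Dh d])
  note idf = tensor_map_hom[OF D D D M i f] and idf_p = tensor_map_pure[OF D D D M i f]
  note Di = tensor_map_hom[OF D M DD M Dh i] and Di_p = tensor_map_pure[OF D M DD M Dh i]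
  note DiD = tensor_map_hom[OF D D DD D Dh i] and DiD_p = tensor_map_pure[OF D D DD D Dh i]
  note iD = tensor_map_hom[OF D D D DD i Dh] and iD_p = tensor_map_pure[OF D D D DD i Dh]
  note il = tensor_map_hom[OF D M D DM i l] and il_p = tensor_map_pure[OF D M D DM i l]
  note asM = tensor_assoc_hom[OF D D M] and asM_p = tensor_assoc_pure[OF D D M]
  note asD = tensor_assoc_hom[OF D D D] and asD_p = tensor_assoc_pure[OF D D D]
  note iidf = tensor_map_hom[OF D DD D DM i idf] and iidf_p = tensor_map_pure[OF D DD D DM i idf]
  let ?idf = "tensor_map K D D D M (\<lambda>x. x) f"
  let ?iidf = "tensor_map K D (tensor K D D) D (tensor K D M) (\<lambda>x. x) ?idf"
  have 1: "tensor_assoc K D D M (pure_tensor K (tensor K D D) M s (f y)) =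
      ?iidf (tensor_assoc K D D D (pure_tensor K (tensor K D D) D s y))"
    if y: "y \<in> carrier D" and s: "s \<in> carrier (tensor K D D)" for s y
    by (rule tensor_hom_ext[OF D D D_DM
          module_hom_comp[OF pure_hom_l[OF DD M module_hom_mem[OF f y]] asM]
          module_hom_comp[OF pure_hom_l[OF DD D y] module_hom_comp[OF asD iidf]] _ s])
       (simp add: asM_p asD_p iidf_p idf_p y module_hom_mem[OF f] pure_tensor_closed D)
  have 2: "tensor_assoc K D D M (tensor_map K D M (tensor K D D) M \<Delta> (\<lambda>x. x) (?idf s)) =
      ?iidf (tensor_assoc K D D D (tensor_map K D D (tensor K D D) D \<Delta> (\<lambda>x. x) s))"
    if s: "s \<in> carrier (tensor K D D)" for s
    by (rule tensor_hom_ext[OF D D D_DM module_hom_comp[OF idf module_hom_comp[OF Di asM]]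
          module_hom_comp[OF DiD module_hom_comp[OF asD iidf]] _ s])
       (simp add: idf_p Di_p DiD_p module_hom_mem[OF f] 1 module_hom_mem[OF Dh])
  have 3: "tensor_map K D M D (tensor K D M) (\<lambda>x. x) l (?idf s) =
      ?iidf (tensor_map K D D D (tensor K D D) (\<lambda>x. x) \<Delta> s)"
    if s: "s \<in> carrier (tensor K D D)" for s
    by (rule tensor_hom_ext[OF D D D_DM module_hom_comp[OF idf il] module_hom_comp[OF iD iidf] _ s])
       (simp add: idf_p il_p iD_p iidf_p module_hom_mem[OF f] lf module_hom_mem[OF Dh])
  show "tensor_assoc K D D M (tensor_map K D M (tensor K D D) M \<Delta> (\<lambda>x. x) (l (f d))) =
      tensor_map K D M D (tensor K D M) (\<lambda>x. x) l (l (f d))"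
    by (simp only: lf[OF d] 2[OF Dd] 3[OF Dd] C.coassoc[OF d])
  note eM = tensor_map_hom[OF D M B M eh i] and eM_p = tensor_map_pure[OF D M B M eh i]
  note eD = tensor_map_hom[OF D D B D eh i] and eD_p = tensor_map_pure[OF D D B D eh i]
  have e: "\<epsilon> x \<in> carrier K" if "x \<in> carrier D" for x
    using module_hom_mem[OF eh that] by simp
  have 4: "tensor_lunit K M (tensor_map K D M (base_field K) M \<epsilon> (\<lambda>x. x) (?idf s)) =
      f (tensor_lunit K D (tensor_map K D D (base_field K) D \<epsilon> (\<lambda>x. x) s))"
    if s: "s \<in> carrier (tensor K D D)" for s
    by (rule tensor_hom_ext[OF D D M
          module_hom_comp[OF idf module_hom_comp[OF eM tensor_lunit_hom[OF M]]]
          module_hom_comp[OF eD module_hom_comp[OF tensor_lunit_hom[OF D] f]] _ s])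
       (simp add: idf_p eM_p eD_p tensor_lunit_pure M D e module_hom_mem[OF f] module_hom_smult[OF f])
  show "tensor_lunit K M (tensor_map K D M (base_field K) M \<epsilon> (\<lambda>x. x) (l (f d))) = f d"
    by (simp only: lf[OF d] 4[OF Dd] C.counit_left[OF d])
qed

lemma right_coaction_on_image:
  assumes "coalgebra K C \<Delta> \<epsilon>" and M: "module K M" and f: "f \<in> module_hom K C M"
    and r: "r \<in> module_hom K M (tensor K M C)"
    and rf: "\<And>c. c \<in> carrier C \<Longrightarrow> r (f c) = tensor_map K C C M C f (\<lambda>x. x) (\<Delta> c)"
    and c: "c \<in> carrier C"
  shows "tensor_assoc K M C C (tensor_map K M C (tensor K M C) C r (\<lambda>x. x) (r (f c))) =
      tensor_map K M C M (tensor K C C) (\<lambda>x. x) \<Delta> (r (f c))"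
    and "tensor_runit K M (tensor_map K M C M (base_field K) (\<lambda>x. x) \<epsilon> (r (f c))) = f c"
proof -
  interpret C: coalgebra K C \<Delta> \<epsilon> by fact
  have C: "module K C" by (rule C.C.module_axioms)
  have B: "module K (base_field K)" by (rule module_base_field[OF C.C.R.is_cring])
  note CC = module_tensor[OF C C] and MC = module_tensor[OF M C]
  note M_CC = module_tensor[OF M CC]
  note Dh = C.comult_hom and eh = C.counit_hom and i = module_hom_id
  have Dc: "\<Delta> c \<in> carrier (tensor K C C)" by (rule module_hom_mem[OF Dh c])
  note fid = tensor_map_hom[OF C C M C f i] and fid_p = tensor_map_pure[OF C C M C f i]
  note ri = tensor_map_hom[OF M C MC C r i] and ri_p = tensor_map_pure[OF M C MC C r i]
  note iDM = tensor_map_hom[OF M C M CC i Dh] and iDM_p = tensor_map_pure[OF M C M CC i Dh]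
  note iD = tensor_map_hom[OF C C C CC i Dh] and iD_p = tensor_map_pure[OF C C C CC i Dh]
  note DiC = tensor_map_hom[OF C C CC C Dh i] and DiC_p = tensor_map_pure[OF C C CC C Dh i]
  note asM = tensor_assoc_hom[OF M C C] and asM_p = tensor_assoc_pure[OF M C C]
  note asC = tensor_assoc_hom[OF C C C] and asC_p = tensor_assoc_pure[OF C C C]
  note fii = tensor_map_hom[OF C CC M CC f i] and fii_p = tensor_map_pure[OF C CC M CC f i]
  let ?fid = "tensor_map K C C M C f (\<lambda>x. x)"
  let ?fii = "tensor_map K C (tensor K C C) M (tensor K C C) f (\<lambda>x. x)"
  have 1: "tensor_assoc K M C C (pure_tensor K (tensor K M C) C (?fid s) y) =
      ?fii (tensor_assoc K C C C (pure_tensor K (tensor K C C) C s y))"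
    if y: "y \<in> carrier C" and s: "s \<in> carrier (tensor K C C)" for s y
    by (rule tensor_hom_ext[OF C C M_CC
          module_hom_comp[OF fid module_hom_comp[OF pure_hom_l[OF MC C y] asM]]
          module_hom_comp[OF pure_hom_l[OF CC C y] module_hom_comp[OF asC fii]] _ s])
       (simp add: asM_p asC_p fii_p fid_p y module_hom_mem[OF f] pure_tensor_closed C)
  have 2: "tensor_assoc K M C C (tensor_map K M C (tensor K M C) C r (\<lambda>x. x) (?fid s)) =
      ?fii (tensor_assoc K C C C (tensor_map K C C (tensor K C C) C \<Delta> (\<lambda>x. x) s))"
    if s: "s \<in> carrier (tensor K C C)" for s
    by (rule tensor_hom_ext[OF C C M_CC module_hom_comp[OF fid module_hom_comp[OF ri asM]]
          module_hom_comp[OF DiC module_hom_comp[OF asC fii]] _ s])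
       (simp add: fid_p ri_p DiC_p module_hom_mem[OF f] rf 1 module_hom_mem[OF Dh])
  have 3: "tensor_map K M C M (tensor K C C) (\<lambda>x. x) \<Delta> (?fid s) =
      ?fii (tensor_map K C C C (tensor K C C) (\<lambda>x. x) \<Delta> s)"
    if s: "s \<in> carrier (tensor K C C)" for s
    by (rule tensor_hom_ext[OF C C M_CC module_hom_comp[OF fid iDM] module_hom_comp[OF iD fii] _ s])
       (simp add: fid_p iDM_p iD_p fii_p module_hom_mem[OF f] module_hom_mem[OF Dh])
  show "tensor_assoc K M C C (tensor_map K M C (tensor K M C) C r (\<lambda>x. x) (r (f c))) =
      tensor_map K M C M (tensor K C C) (\<lambda>x. x) \<Delta> (r (f c))"
    by (simp only: rf[OF c] 2[OF Dc] 3[OF Dc] C.coassoc[OF c])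
  note eM = tensor_map_hom[OF M C M B i eh] and eM_p = tensor_map_pure[OF M C M B i eh]
  note eC = tensor_map_hom[OF C C C B i eh] and eC_p = tensor_map_pure[OF C C C B i eh]
  have e: "\<epsilon> x \<in> carrier K" if "x \<in> carrier C" for x
    using module_hom_mem[OF eh that] by simp
  have 4: "tensor_runit K M (tensor_map K M C M (base_field K) (\<lambda>x. x) \<epsilon> (?fid s)) =
      f (tensor_runit K C (tensor_map K C C C (base_field K) (\<lambda>x. x) \<epsilon> s))"
    if s: "s \<in> carrier (tensor K C C)" for s
    by (rule tensor_hom_ext[OF C C M
          module_hom_comp[OF fid module_hom_comp[OF eM tensor_runit_hom[OF M]]]
          module_hom_comp[OF eC module_hom_comp[OF tensor_runit_hom[OF C] f]] _ s])
       (simp add: fid_p eM_p eC_p tensor_runit_pure M C e module_hom_mem[OF f] module_hom_smult[OF f])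
  show "tensor_runit K M (tensor_map K M C M (base_field K) (\<lambda>x. x) \<epsilon> (r (f c))) = f c"
    by (simp only: rf[OF c] 4[OF Dc] C.counit_right[OF c])
qed

lemma bicomodule_tensorI:
  assumes cC: "coalgebra K C \<Delta>C \<epsilon>C" and cD: "coalgebra K D \<Delta>D \<epsilon>D"
    and V: "module K V" and W: "module K W"
    and b: "bilinear_map K D C (tensor K V W) b"
    and gen: "\<And>v w. v \<in> carrier V \<Longrightarrow> w \<in> carrier W \<Longrightarrow>
      \<exists>d\<in>carrier D. \<exists>c\<in>carrier C. pure_tensor K V W v w = b d c"
    and l: "l \<in> module_hom K (tensor K V W) (tensor K D (tensor K V W))"
    and r: "r \<in> module_hom K (tensor K V W) (tensor K (tensor K V W) C)"
    and lb: "\<And>d c. d \<in> carrier D \<Longrightarrow> c \<in> carrier C \<Longrightarrow>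
      l (b d c) = tensor_map K D D D (tensor K V W) (\<lambda>x. x) (\<lambda>d. b d c) (\<Delta>D d)"
    and rb: "\<And>d c. d \<in> carrier D \<Longrightarrow> c \<in> carrier C \<Longrightarrow>
      r (b d c) = tensor_map K C C (tensor K V W) C (\<lambda>c. b d c) (\<lambda>x. x) (\<Delta>C c)"
  shows "bicomodule K D \<Delta>D \<epsilon>D C \<Delta>C \<epsilon>C (tensor K V W) l r"
proof -
  interpret cC: coalgebra K C \<Delta>C \<epsilon>C by fact
  interpret cD: coalgebra K D \<Delta>D \<epsilon>D by fact
  let ?M = "tensor K V W"
  have C: "module K C" by (rule cC.C.module_axioms)
  have D: "module K D" by (rule cD.C.module_axioms)
  have B: "module K (base_field K)" by (rule module_base_field[OF cC.C.R.is_cring])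
  have M: "module K ?M" by (rule module_tensor[OF V W])
  note i = module_hom_id
  note CC = module_tensor[OF C C] and DD = module_tensor[OF D D]
  note DM = module_tensor[OF D M] and MC = module_tensor[OF M C]
  note D_DM = module_tensor[OF D DM] and M_CC = module_tensor[OF M CC]
  note D_MC = module_tensor[OF D MC]
  have p: "(\<lambda>d. b d c) \<in> module_hom K D ?M" if "c \<in> carrier C" for c
    using b that by (simp add: bilinear_map_def)
  have q: "b d \<in> module_hom K C ?M" if "d \<in> carrier D" for d
    using b that by (simp add: bilinear_map_def)
  have bM: "b d c \<in> carrier ?M" if "d \<in> carrier D" "c \<in> carrier C" for d c
    using module_hom_mem[OF q[OF that(1)] that(2)] .
  note li = tensor_map_hom[OF M C DM C l i] and li_p = tensor_map_pure[OF M C DM C l i]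
  note ir = tensor_map_hom[OF D M D MC i r] and ir_p = tensor_map_pure[OF D M D MC i r]
  note as = tensor_assoc_hom[OF D M C] and as_p = tensor_assoc_pure[OF D M C]
  note ip = tensor_map_hom[OF D D D M i p] and ip_p = tensor_map_pure[OF D D D M i p]
  note qi = tensor_map_hom[OF C C M C q i] and qi_p = tensor_map_pure[OF C C M C q i]
  have "left_comodule K D \<Delta>D \<epsilon>D ?M l"
  proof (intro left_comodule.intro left_comodule_axioms.intro)
    fix m assume m: "m \<in> carrier ?M"
    show "tensor_assoc K D D ?M (tensor_map K D ?M (tensor K D D) ?M \<Delta>D (\<lambda>x. x) (l m)) =
        tensor_map K D ?M D (tensor K D ?M) (\<lambda>x. x) l (l m)"
    proof (rule tensor_hom_ext[OF V W D_DM module_hom_comp[OF l module_hom_comp[OF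
              tensor_map_hom[OF D M DD M cD.comult_hom i] tensor_assoc_hom[OF D D M]]]
            module_hom_comp[OF l tensor_map_hom[OF D M D DM i l]] _ m])
      fix v w assume "v \<in> carrier V" "w \<in> carrier W"
      then obtain d c where dc: "d \<in> carrier D" "c \<in> carrier C" "pure_tensor K V W v w = b d c"
        using gen by metis
      show "tensor_assoc K D D ?M
          (tensor_map K D ?M (tensor K D D) ?M \<Delta>D (\<lambda>x. x) (l (pure_tensor K V W v w))) =
          tensor_map K D ?M D (tensor K D ?M) (\<lambda>x. x) l (l (pure_tensor K V W v w))"
        unfolding dc(3)
        by (rule left_coaction_on_image(1)[OF cD M p[OF dc(2)] l lb[OF _ dc(2)] dc(1)])
    qed
    show "tensor_lunit K ?M (tensor_map K D ?M (base_field K) ?M \<epsilon>D (\<lambda>x. x) (l m)) = m"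
    proof (rule tensor_hom_ext[OF V W M module_hom_comp[OF l module_hom_comp[OF
              tensor_map_hom[OF D M B M cD.counit_hom i] tensor_lunit_hom[OF M]]] i _ m])
      fix v w assume "v \<in> carrier V" "w \<in> carrier W"
      then obtain d c where dc: "d \<in> carrier D" "c \<in> carrier C" "pure_tensor K V W v w = b d c"
        using gen by metis
      show "tensor_lunit K ?M (tensor_map K D ?M (base_field K) ?M \<epsilon>D (\<lambda>x. x)
          (l (pure_tensor K V W v w))) = pure_tensor K V W v w"
        unfolding dc(3)
        by (rule left_coaction_on_image(2)[OF cD M p[OF dc(2)] l lb[OF _ dc(2)] dc(1)])
    qed
  qed (fact cD l vectorspaceI[OF M cC.C.field_axioms])+
  moreover have "right_comodule K C \<Delta>C \<epsilon>C ?M r"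
  proof (intro right_comodule.intro right_comodule_axioms.intro)
    fix m assume m: "m \<in> carrier ?M"
    show "tensor_assoc K ?M C C (tensor_map K ?M C (tensor K ?M C) C r (\<lambda>x. x) (r m)) =
        tensor_map K ?M C ?M (tensor K C C) (\<lambda>x. x) \<Delta>C (r m)"
    proof (rule tensor_hom_ext[OF V W M_CC module_hom_comp[OF r module_hom_comp[OF
              tensor_map_hom[OF M C MC C r i] tensor_assoc_hom[OF M C C]]]
            module_hom_comp[OF r tensor_map_hom[OF M C M CC i cC.comult_hom]] _ m])
      fix v w assume "v \<in> carrier V" "w \<in> carrier W"
      then obtain d c where dc: "d \<in> carrier D" "c \<in> carrier C" "pure_tensor K V W v w = b d c"
        using gen by metis
      show "tensor_assoc K ?M C C
          (tensor_map K ?M C (tensor K ?M C) C r (\<lambda>x. x) (r (pure_tensor K V W v w))) =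
          tensor_map K ?M C ?M (tensor K C C) (\<lambda>x. x) \<Delta>C (r (pure_tensor K V W v w))"
        unfolding dc(3)
        by (rule right_coaction_on_image(1)[OF cC M q[OF dc(1)] r rb[OF dc(1)] dc(2)])
    qed
    show "tensor_runit K ?M (tensor_map K ?M C ?M (base_field K) (\<lambda>x. x) \<epsilon>C (r m)) = m"
    proof (rule tensor_hom_ext[OF V W M module_hom_comp[OF r module_hom_comp[OF
              tensor_map_hom[OF M C M B i cC.counit_hom] tensor_runit_hom[OF M]]] i _ m])
      fix v w assume "v \<in> carrier V" "w \<in> carrier W"
      then obtain d c where dc: "d \<in> carrier D" "c \<in> carrier C" "pure_tensor K V W v w = b d c"
        using gen by metis
      show "tensor_runit K ?M (tensor_map K ?M C ?M (base_field K) (\<lambda>x. x) \<epsilon>C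
          (r (pure_tensor K V W v w))) = pure_tensor K V W v w"
        unfolding dc(3)
        by (rule right_coaction_on_image(2)[OF cC M q[OF dc(1)] r rb[OF dc(1)] dc(2)])
    qed
  qed (fact cC r vectorspaceI[OF M cC.C.field_axioms])+
  moreover have "bicomodule_axioms K D C ?M l r"
  proof (rule bicomodule_axioms.intro)
    fix m assume m: "m \<in> carrier ?M"
    let ?as = "tensor_assoc K D ?M C"
    let ?li = "tensor_map K ?M C (tensor K D ?M) C l (\<lambda>x. x)"
    let ?ir = "tensor_map K D ?M D (tensor K ?M C) (\<lambda>x. x) r"
    let ?qi = "\<lambda>y. tensor_map K C C ?M C (b y) (\<lambda>x. x)"
    let ?ip = "\<lambda>c. tensor_map K D D D ?M (\<lambda>x. x) (\<lambda>d. b d c)"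
    let ?H = "\<lambda>t. tensor_map K D D D (tensor K ?M C) (\<lambda>x. x) (\<lambda>y. ?qi y t)"
    have qih: "(\<lambda>y. ?qi y t) \<in> module_hom K D (tensor K ?M C)"
      if t: "t \<in> carrier (tensor K C C)" for t
      unfolding tensor_map_def
    proof (rule tensor_lift_param_hom[OF C C D MC _ _ t])
      fix y assume y: "y \<in> carrier D"
      show "bilinear_map K C C (tensor K ?M C) (\<lambda>v w. pure_tensor K ?M C (b y v) w)"
        by (rule bilinear_mapI) (rule pure_hom_r[OF M C bM[OF y]] module_hom_comp[OF q[OF y] pure_hom_l[OF M C]], assumption)+
    next
      fix u v assume u: "u \<in> carrier C" and v: "v \<in> carrier C"
      show "(\<lambda>y. pure_tensor K ?M C (b y u) v) \<in> module_hom K D (tensor K ?M C)"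
        by (rule module_hom_comp[OF p[OF u] pure_hom_l[OF M C v]])
    qed
    have Hp: "?H t (pure_tensor K D D x y) = pure_tensor K D (tensor K ?M C) x (?qi y t)"
      if "t \<in> carrier (tensor K C C)" "x \<in> carrier D" "y \<in> carrier D" for t x y
      using tensor_map_pure[OF D D D MC i qih[OF that(1)] that(2,3)] .
    have Hs: "?H t \<in> module_hom K (tensor K D D) (tensor K D (tensor K ?M C))"
      if "t \<in> carrier (tensor K C C)" for t
      by (rule tensor_map_hom[OF D D D MC i qih[OF that]])
    have Ht: "(\<lambda>t. ?H t s) \<in> module_hom K (tensor K C C) (tensor K D (tensor K ?M C))"
      if s: "s \<in> carrier (tensor K D D)" for s
      unfolding tensor_map_def[of K D D]
    proof (rule tensor_lift_param_hom[OF D D CC D_MC _ _ s])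
      fix t assume t: "t \<in> carrier (tensor K C C)"
      show "bilinear_map K D D (tensor K D (tensor K ?M C))
          (\<lambda>x y. pure_tensor K D (tensor K ?M C) x (?qi y t))"
      proof (rule bilinear_mapI)
        fix x assume x: "x \<in> carrier D"
        show "(\<lambda>y. pure_tensor K D (tensor K ?M C) x (?qi y t)) \<in>
            module_hom K D (tensor K D (tensor K ?M C))"
          by (rule module_hom_comp[OF qih[OF t] pure_hom_r[OF D MC x]])
      next
        fix y assume y: "y \<in> carrier D"
        show "(\<lambda>x. pure_tensor K D (tensor K ?M C) x (?qi y t)) \<in>
            module_hom K D (tensor K D (tensor K ?M C))"
          by (rule pure_hom_l[OF D MC module_hom_mem[OF qi[OF y] t]])
      qed
    next
      fix x y assume x: "x \<in> carrier D" and y: "y \<in> carrier D"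
      show "(\<lambda>t. pure_tensor K D (tensor K ?M C) x (?qi y t)) \<in>
          module_hom K (tensor K C C) (tensor K D (tensor K ?M C))"
        by (rule module_hom_comp[OF qi[OF y] pure_hom_r[OF D MC x]])
    qed
    have 1: "?ir (?ip c s) = ?H (\<Delta>C c) s"
      if c: "c \<in> carrier C" and s: "s \<in> carrier (tensor K D D)" for c s
    proof -
      have t: "\<Delta>C c \<in> carrier (tensor K C C)" by (rule module_hom_mem[OF cC.comult_hom c])
      show ?thesis
        by (rule tensor_hom_ext[OF D D D_MC module_hom_comp[OF ip[OF c] ir] Hs[OF t] _ s])
           (simp add: ip_p[OF c] ir_p bM c rb Hp t)
    qed
    have 2: "?as (pure_tensor K (tensor K D ?M) C (?ip x s) y) = ?H (pure_tensor K C C x y) s"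
      if x: "x \<in> carrier C" and y: "y \<in> carrier C" and s: "s \<in> carrier (tensor K D D)" for x y s
    proof -
      have t: "pure_tensor K C C x y \<in> carrier (tensor K C C)"
        by (rule pure_tensor_closed[OF C C x y])
      show ?thesis
        by (rule tensor_hom_ext[OF D D D_MC
              module_hom_comp[OF ip[OF x] module_hom_comp[OF pure_hom_l[OF DM C y] as]] Hs[OF t] _ s])
           (simp add: ip_p[OF x] as_p bM x y Hp t qi_p)
    qed
    have 3: "?as (?li (?qi d t)) = ?H t (\<Delta>D d)"
      if d: "d \<in> carrier D" and t: "t \<in> carrier (tensor K C C)" for d t
    proof -
      have s: "\<Delta>D d \<in> carrier (tensor K D D)" by (rule module_hom_mem[OF cD.comult_hom d])
      show ?thesis
        by (rule tensor_hom_ext[OF C C D_MC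
              module_hom_comp[OF qi[OF d] module_hom_comp[OF li as]] Ht[OF s] _ t])
           (simp add: qi_p[OF d] li_p bM d lb 2 s)
    qed
    show "?as (?li (r m)) = ?ir (l m)"
    proof (rule tensor_hom_ext[OF V W D_MC module_hom_comp[OF r module_hom_comp[OF li as]]
            module_hom_comp[OF l ir] _ m])
      fix v w assume "v \<in> carrier V" "w \<in> carrier W"
      then obtain d c where dc: "d \<in> carrier D" "c \<in> carrier C" "pure_tensor K V W v w = b d c"
        using gen by metis
      show "?as (?li (r (pure_tensor K V W v w))) = ?ir (l (pure_tensor K V W v w))"
        unfolding dc(3) lb[OF dc(1,2)] rb[OF dc(1,2)]
        using 3[OF dc(1) module_hom_mem[OF cC.comult_hom dc(2)]]
          1[OF dc(2) module_hom_mem[OF cD.comult_hom dc(1)]] by simp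
    qed
  qed
  ultimately show ?thesis by (rule bicomodule.intro)
qed

theorem bicomodule_DC:
  assumes cC: "coalgebra K C \<Delta>C \<epsilon>C" and cD: "coalgebra K D \<Delta>D \<epsilon>D"
  shows "bicomodule K D \<Delta>D \<epsilon>D C \<Delta>C \<epsilon>C (tensor K D C) (lcoact_DC K D \<Delta>D C) (rcoact_DC K D C \<Delta>C)"
proof -
  interpret cC: coalgebra K C \<Delta>C \<epsilon>C by fact
  interpret cD: coalgebra K D \<Delta>D \<epsilon>D by fact
  have C: "module K C" by (rule cC.C.module_axioms)
  have D: "module K D" by (rule cD.C.module_axioms)
  note DC = module_tensor[OF D C] and CC = module_tensor[OF C C] and DD = module_tensor[OF D D]
  note D_DC = module_tensor[OF D DC] and DC_C = module_tensor[OF DC C]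
  note i = module_hom_id
  note Di = tensor_map_hom[OF D C DD C cD.comult_hom i]
    and Di_p = tensor_map_pure[OF D C DD C cD.comult_hom i]
  note iD = tensor_map_hom[OF D C D CC i cC.comult_hom]
    and iD_p = tensor_map_pure[OF D C D CC i cC.comult_hom]
  show ?thesis
  proof (rule bicomodule_tensorI[OF cC cD D C bilinear_pure_tensor[OF D C]])
    show "lcoact_DC K D \<Delta>D C \<in> module_hom K (tensor K D C) (tensor K D (tensor K D C))"
      unfolding lcoact_DC_def by (rule module_hom_comp[OF Di tensor_assoc_hom[OF D D C]])
    show "rcoact_DC K D C \<Delta>C \<in> module_hom K (tensor K D C) (tensor K (tensor K D C) C)"
      unfolding rcoact_DC_def by (rule module_hom_comp[OF iD tensor_unassoc_hom[OF D C C]])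
  next
    fix d c assume d: "d \<in> carrier D" and c: "c \<in> carrier C"
    note pl = pure_hom_l[OF D C c] and pr = pure_hom_r[OF D C d]
    have 1: "tensor_assoc K D D C (pure_tensor K (tensor K D D) C s c) =
        tensor_map K D D D (tensor K D C) (\<lambda>x. x) (\<lambda>d. pure_tensor K D C d c) s"
      if s: "s \<in> carrier (tensor K D D)" for s
      by (rule tensor_hom_ext[OF D D D_DC
            module_hom_comp[OF pure_hom_l[OF DD C c] tensor_assoc_hom[OF D D C]]
            tensor_map_hom[OF D D D DC i pl] _ s])
         (simp add: tensor_assoc_pure[OF D D C] tensor_map_pure[OF D D D DC i pl] c)
    show "lcoact_DC K D \<Delta>D C (pure_tensor K D C d c) =
        tensor_map K D D D (tensor K D C) (\<lambda>x. x) (\<lambda>d. pure_tensor K D C d c) (\<Delta>D d)"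
      using 1[OF module_hom_mem[OF cD.comult_hom d]] by (simp add: lcoact_DC_def Di_p d c)
    have 2: "tensor_unassoc K D C C (pure_tensor K D (tensor K C C) d s) =
        tensor_map K C C (tensor K D C) C (pure_tensor K D C d) (\<lambda>x. x) s"
      if s: "s \<in> carrier (tensor K C C)" for s
      by (rule tensor_hom_ext[OF C C DC_C
            module_hom_comp[OF pure_hom_r[OF D CC d] tensor_unassoc_hom[OF D C C]]
            tensor_map_hom[OF C C DC C pr i] _ s])
         (simp add: tensor_unassoc_pure[OF D C C] tensor_map_pure[OF C C DC C pr i] d)
    show "rcoact_DC K D C \<Delta>C (pure_tensor K D C d c) =
        tensor_map K C C (tensor K D C) C (pure_tensor K D C d) (\<lambda>x. x) (\<Delta>C c)"
      using 2[OF module_hom_mem[OF cC.comult_hom c]] by (simp add: rcoact_DC_def iD_p d c)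
  qed blast
qed

theorem bicomodule_CD:
  assumes cC: "coalgebra K C \<Delta>C \<epsilon>C" and cD: "coalgebra K D \<Delta>D \<epsilon>D"
  shows "bicomodule K D \<Delta>D \<epsilon>D C \<Delta>C \<epsilon>C (tensor K C D) (lcoact_CD K C D \<Delta>D) (rcoact_CD K C \<Delta>C D)"
proof -
  interpret cC: coalgebra K C \<Delta>C \<epsilon>C by fact
  interpret cD: coalgebra K D \<Delta>D \<epsilon>D by fact
  have C: "module K C" by (rule cC.C.module_axioms)
  have D: "module K D" by (rule cD.C.module_axioms)
  note CD = module_tensor[OF C D] and CC = module_tensor[OF C C] and DD = module_tensor[OF D D]
  note D_CD = module_tensor[OF D CD] and CD_C = module_tensor[OF CD C]
  note i = module_hom_id
  let ?l = "\<lambda>c d. tensor_map K D D D (tensor K C D) (\<lambda>x. x) (\<lambda>d. pure_tensor K C D c d) (\<Delta>D d)"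
  let ?r = "\<lambda>c d. tensor_map K C C (tensor K C D) C (\<lambda>c. pure_tensor K C D c d) (\<lambda>x. x) (\<Delta>C c)"
  have l: "bilinear_map K C D (tensor K D (tensor K C D)) ?l"
  proof (rule bilinear_mapI)
    fix c assume c: "c \<in> carrier C"
    show "?l c \<in> module_hom K D (tensor K D (tensor K C D))"
      by (rule module_hom_comp[OF cD.comult_hom tensor_map_hom[OF D D D CD i pure_hom_r[OF C D c]]])
  next
    fix d assume d: "d \<in> carrier D"
    show "(\<lambda>c. ?l c d) \<in> module_hom K C (tensor K D (tensor K C D))"
      unfolding tensor_map_def
    proof (rule tensor_lift_param_hom[OF D D C D_CD _ _ module_hom_mem[OF cD.comult_hom d]])
      fix c assume c: "c \<in> carrier C"
      show "bilinear_map K D D (tensor K D (tensor K C D))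
          (\<lambda>x y. pure_tensor K D (tensor K C D) x (pure_tensor K C D c y))"
        by (rule bilinear_mapI)
           (rule module_hom_comp[OF pure_hom_r[OF C D c] pure_hom_r[OF D CD]]
              pure_hom_l[OF D CD pure_tensor_closed[OF C D c]], assumption)+
    next
      fix x y assume x: "x \<in> carrier D" and y: "y \<in> carrier D"
      show "(\<lambda>c. pure_tensor K D (tensor K C D) x (pure_tensor K C D c y)) \<in>
          module_hom K C (tensor K D (tensor K C D))"
        by (rule module_hom_comp[OF pure_hom_l[OF C D y] pure_hom_r[OF D CD x]])
    qed
  qed
  have r: "bilinear_map K C D (tensor K (tensor K C D) C) ?r"
  proof (rule bilinear_mapI)
    fix d assume d: "d \<in> carrier D"
    show "(\<lambda>c. ?r c d) \<in> module_hom K C (tensor K (tensor K C D) C)"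
      by (rule module_hom_comp[OF cC.comult_hom tensor_map_hom[OF C C CD C pure_hom_l[OF C D d] i]])
  next
    fix c assume c: "c \<in> carrier C"
    show "?r c \<in> module_hom K D (tensor K (tensor K C D) C)"
      unfolding tensor_map_def
    proof (rule tensor_lift_param_hom[OF C C D CD_C _ _ module_hom_mem[OF cC.comult_hom c]])
      fix d assume d: "d \<in> carrier D"
      show "bilinear_map K C C (tensor K (tensor K C D) C)
          (\<lambda>x y. pure_tensor K (tensor K C D) C (pure_tensor K C D x d) y)"
        by (rule bilinear_mapI)
           (rule pure_hom_r[OF CD C pure_tensor_closed[OF C D _ d]]
              module_hom_comp[OF pure_hom_l[OF C D d] pure_hom_l[OF CD C]], assumption)+
    next
      fix x y assume x: "x \<in> carrier C" and y: "y \<in> carrier C"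
      show "(\<lambda>d. pure_tensor K (tensor K C D) C (pure_tensor K C D x d) y) \<in>
          module_hom K D (tensor K (tensor K C D) C)"
        by (rule module_hom_comp[OF pure_hom_r[OF C D x] pure_hom_l[OF CD C y]])
    qed
  qed
  have ld: "lcoact_CD K C D \<Delta>D = tensor_lift K C D (tensor K D (tensor K C D)) ?l"
    by (simp add: lcoact_CD_def tensor_map_def)
  have rd: "rcoact_CD K C \<Delta>C D = tensor_lift K C D (tensor K (tensor K C D) C) ?r"
    by (simp add: rcoact_CD_def tensor_map_def)
  show ?thesis
  proof (rule bicomodule_tensorI[OF cC cD C D, where b = "\<lambda>d c. pure_tensor K C D c d"])
    show "bilinear_map K D C (tensor K C D) (\<lambda>d c. pure_tensor K C D c d)"
      by (rule bilinear_mapI) (rule pure_hom_l[OF C D] pure_hom_r[OF C D], assumption)+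
    show "lcoact_CD K C D \<Delta>D \<in> module_hom K (tensor K C D) (tensor K D (tensor K C D))"
      unfolding ld by (rule tensor_lift_hom[OF C D D_CD l])
    show "rcoact_CD K C \<Delta>C D \<in> module_hom K (tensor K C D) (tensor K (tensor K C D) C)"
      unfolding rd by (rule tensor_lift_hom[OF C D CD_C r])
  next
    fix d c assume d: "d \<in> carrier D" and c: "c \<in> carrier C"
    show "lcoact_CD K C D \<Delta>D (pure_tensor K C D c d) = ?l c d"
      unfolding ld by (rule tensor_lift_pure[OF C D D_CD l c d])
    show "rcoact_CD K C \<Delta>C D (pure_tensor K C D c d) = ?r c d"
      unfolding rd by (rule tensor_lift_pure[OF C D CD_C r c d])
  qed blast
qed

end

theory Submission
  imports Defs
begin

text \<open>
  The bicomodule \<open>D \<otimes> C\<close>, with left coaction \<open>\<Delta>D \<otimes> id\<close>, is the cofree left \<open>D\<close>-comodule on the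
  vector space \<open>C\<close>. Hence a left colinear map \<open>f\<close> into it is determined by its composite with the
  projection \<open>\<epsilon>D \<otimes> id : D \<otimes> C \<rightarrow> C\<close>, namely \<open>f(m) = m\<^sub>-\<^sub>1 \<otimes> (\<epsilon>D \<otimes> id) (f(m\<^sub>0))\<close>: apply
  \<open>id \<otimes> \<epsilon>D \<otimes> id\<close> to the colinearity equation and use the counit law on the left hand side. This
  uniqueness is \<open>colinear_into_cofree_eqI\<close>.

  The flip \<open>\<tau>\<close> is itself conormal, as one sees on pure tensors (\<open>tensor_flip_conormal\<close>), and left
  colinear, because the left coaction of \<open>C \<otimes> D\<close> is the coaction of \<open>D \<otimes> C\<close> carried over along
  \<open>\<tau>\<close> (\<open>tensor_flip_left_colinear\<close>). The first conormality equation for \<open>\<Psi>\<close> therefore reads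
  \<open>(\<epsilon>D \<otimes> id) \<Psi> = (\<epsilon>D \<otimes> id) \<tau>\<close>, and for a left colinear \<open>\<Psi>\<close> this forces \<open>\<Psi> = \<tau>\<close>.
\<close>

section \<open>Functoriality of the tensor product\<close>

lemma tensor_map_comp:
  assumes "module K U" "module K V" "module K U'" "module K V'" "module K U''" "module K V''"
    and f: "f \<in> module_hom K U U'" and g: "g \<in> module_hom K V V'"
    and f': "f' \<in> module_hom K U' U''" and g': "g' \<in> module_hom K V' V''"
    and t: "t \<in> carrier (tensor K U V)"
  shows "tensor_map K U' V' U'' V'' f' g' (tensor_map K U V U' V' f g t) =
    tensor_map K U V U'' V'' (\<lambda>x. f' (f x)) (\<lambda>y. g' (g y)) t"
proof -
  note ff = module_hom_comp[OF f f'] and gg = module_hom_comp[OF g g']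
  show ?thesis
    by (rule tensor_hom_ext[OF assms(1,2) module_tensor[OF assms(5,6)]
          module_hom_comp[OF tensor_map_hom[OF assms(1-4) f g] tensor_map_hom[OF assms(3-6) f' g']]
          tensor_map_hom[OF assms(1,2,5,6) ff gg] _ t])
       (simp add: tensor_map_pure[OF assms(1-4) f g] tensor_map_pure[OF assms(3-6) f' g']
         tensor_map_pure[OF assms(1,2,5,6) ff gg] module_hom_mem[OF f] module_hom_mem[OF g])
qed

lemma tensor_map_cong:
  assumes m: "module K U" "module K V" "module K U'" "module K V'"
    and f: "f \<in> module_hom K U U'" and g: "g \<in> module_hom K V V'"
    and f': "f' \<in> module_hom K U U'" and g': "g' \<in> module_hom K V V'"
    and "\<And>x. x \<in> carrier U \<Longrightarrow> f x = f' x" "\<And>y. y \<in> carrier V \<Longrightarrow> g y = g' y"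
    and t: "t \<in> carrier (tensor K U V)"
  shows "tensor_map K U V U' V' f g t = tensor_map K U V U' V' f' g' t"
  by (rule tensor_hom_ext[OF m(1,2) module_tensor[OF m(3,4)]
        tensor_map_hom[OF m f g] tensor_map_hom[OF m f' g'] _ t])
     (simp add: tensor_map_pure[OF m f g] tensor_map_pure[OF m f' g'] assms)

section \<open>The left coactions\<close>

lemma lcoact_DC_hom:
  assumes "coalgebra K D \<Delta> \<epsilon>" and C: "module K C"
  shows "lcoact_DC K D \<Delta> C \<in> module_hom K (tensor K D C) (tensor K D (tensor K D C))"
proof -
  interpret D: coalgebra K D \<Delta> \<epsilon> by fact
  have D: "module K D" by (rule D.C.module_axioms)
  show ?thesis
    unfolding lcoact_DC_def
    by (rule module_hom_comp[OF
          tensor_map_hom[OF D C module_tensor[OF D D] C D.comult_hom module_hom_id]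
          tensor_assoc_hom[OF D D C]])
qed

text \<open>Expressing both coactions as \<open>id \<otimes> f\<close> applied to \<open>\<Delta> d\<close>, for a linear map \<open>f\<close> that depends on
  \<open>c\<close>, replaces Sweedler calculations by functoriality of the tensor product: no decomposition of
  \<open>\<Delta> d\<close> into pure tensors is ever chosen.\<close>

lemma lcoact_DC_pure:
  assumes "coalgebra K D \<Delta> \<epsilon>" and C: "module K C" and d: "d \<in> carrier D" and c: "c \<in> carrier C"
  shows "lcoact_DC K D \<Delta> C (pure_tensor K D C d c) =
    tensor_map K D D D (tensor K D C) (\<lambda>x. x) (\<lambda>y. pure_tensor K D C y c) (\<Delta> d)"
proof -
  interpret D: coalgebra K D \<Delta> \<epsilon> by fact
  have D: "module K D" by (rule D.C.module_axioms)
  note DC = module_tensor[OF D C] and DD = module_tensor[OF D D]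
  note i = module_hom_id and pl = pure_hom_l[OF D C c]
  have "tensor_assoc K D D C (pure_tensor K (tensor K D D) C s c) =
      tensor_map K D D D (tensor K D C) (\<lambda>x. x) (\<lambda>y. pure_tensor K D C y c) s"
    if s: "s \<in> carrier (tensor K D D)" for s
    by (rule tensor_hom_ext[OF D D module_tensor[OF D DC]
          module_hom_comp[OF pure_hom_l[OF DD C c] tensor_assoc_hom[OF D D C]]
          tensor_map_hom[OF D D D DC i pl] _ s])
       (simp add: tensor_assoc_pure[OF D D C] tensor_map_pure[OF D D D DC i pl] c)
  then show ?thesis
    using module_hom_mem[OF D.comult_hom d]
    by (simp add: lcoact_DC_def tensor_map_pure[OF D C DD C D.comult_hom i] d c)
qed

lemma lcoact_CD_pure:
  assumes "coalgebra K D \<Delta> \<epsilon>" and C: "module K C" and c: "c \<in> carrier C" and d: "d \<in> carrier D"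
  shows "lcoact_CD K C D \<Delta> (pure_tensor K C D c d) =
    tensor_map K D D D (tensor K C D) (\<lambda>x. x) (pure_tensor K C D c) (\<Delta> d)"
proof -
  interpret D: coalgebra K D \<Delta> \<epsilon> by fact
  have D: "module K D" by (rule D.C.module_axioms)
  note CD = module_tensor[OF C D]
  note D_CD = module_tensor[OF D CD]
  let ?l = "\<lambda>c d. tensor_map K D D D (tensor K C D) (\<lambda>x. x) (pure_tensor K C D c) (\<Delta> d)"
  have "bilinear_map K C D (tensor K D (tensor K C D)) ?l"
  proof (rule bilinear_mapI)
    fix c assume c: "c \<in> carrier C"
    show "?l c \<in> module_hom K D (tensor K D (tensor K C D))"
      by (rule module_hom_comp[OF D.comult_hom
            tensor_map_hom[OF D D D CD module_hom_id pure_hom_r[OF C D c]]])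
  next
    fix d assume d: "d \<in> carrier D"
    show "(\<lambda>c. ?l c d) \<in> module_hom K C (tensor K D (tensor K C D))"
      unfolding tensor_map_def
    proof (rule tensor_lift_param_hom[OF D D C D_CD _ _ module_hom_mem[OF D.comult_hom d]])
      fix c assume c: "c \<in> carrier C"
      show "bilinear_map K D D (tensor K D (tensor K C D))
          (\<lambda>x y. pure_tensor K D (tensor K C D) x (pure_tensor K C D c y))"
        by (rule bilinear_mapI)
           (rule module_hom_comp[OF pure_hom_r[OF C D c] pure_hom_r[OF D CD]]
              pure_hom_l[OF D CD pure_tensor_closed[OF C D c]], assumption)+
    next
      fix x y assume x: "x \<in> carrier D" and y: "y \<in> carrier D"
      show "(\<lambda>c. pure_tensor K D (tensor K C D) x (pure_tensor K C D c y)) \<in>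
          module_hom K C (tensor K D (tensor K C D))"
        by (rule module_hom_comp[OF pure_hom_l[OF C D y] pure_hom_r[OF D CD x]])
    qed
  qed
  moreover have "lcoact_CD K C D \<Delta> = tensor_lift K C D (tensor K D (tensor K C D)) ?l"
    by (simp add: lcoact_CD_def tensor_map_def)
  ultimately show ?thesis
    using tensor_lift_pure[OF C D D_CD _ c d] by simp
qed

section \<open>Colinear maps into a cofree comodule\<close>

text \<open>The map \<open>\<epsilon> \<otimes> id : D \<otimes> C \<rightarrow> C\<close>, the projection of the cofree comodule \<open>D \<otimes> C\<close> onto its
  cogenerators.\<close>

abbreviation cofree_proj where
  "cofree_proj K D \<epsilon> C t \<equiv>
    tensor_lunit K C (tensor_map K D C (base_field K) C \<epsilon> (\<lambda>x. x) t)"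

lemma
  assumes "cring K" and D: "module K D" and C: "module K C"
    and e: "\<epsilon> \<in> module_hom K D (base_field K)"
  shows cofree_proj_hom: "cofree_proj K D \<epsilon> C \<in> module_hom K (tensor K D C) C"
    and cofree_proj_pure: "d \<in> carrier D \<Longrightarrow> c \<in> carrier C \<Longrightarrow>
      cofree_proj K D \<epsilon> C (pure_tensor K D C d c) = \<epsilon> d \<odot>\<^bsub>C\<^esub> c"
proof -
  note B = module_base_field[OF \<open>cring K\<close>]
  show "cofree_proj K D \<epsilon> C \<in> module_hom K (tensor K D C) C"
    by (rule module_hom_comp[OF tensor_map_hom[OF D C B C e module_hom_id] tensor_lunit_hom[OF C]])
  show "cofree_proj K D \<epsilon> C (pure_tensor K D C d c) = \<epsilon> d \<odot>\<^bsub>C\<^esub> c"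
    if "d \<in> carrier D" "c \<in> carrier C"
    using that module_hom_mem[OF e]
    by (simp add: tensor_map_pure[OF D C B C e module_hom_id] tensor_lunit_pure[OF C])
qed

text \<open>On \<open>d \<otimes> c\<close> this is \<open>d\<^sub>1 \<otimes> \<epsilon>(d\<^sub>2) c = d\<^sub>1 \<epsilon>(d\<^sub>2) \<otimes> c\<close>, so it is the right counit law of \<open>D\<close>.\<close>

lemma cofree_proj_lcoact_DC:
  assumes "coalgebra K D \<Delta> \<epsilon>" and C: "module K C" and t: "t \<in> carrier (tensor K D C)"
  shows "tensor_map K D (tensor K D C) D C (\<lambda>x. x) (cofree_proj K D \<epsilon> C)
    (lcoact_DC K D \<Delta> C t) = t"
proof -
  interpret D: coalgebra K D \<Delta> \<epsilon> by fact
  have D: "module K D" by (rule D.C.module_axioms)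
  have K: "cring K" by (rule D.C.R.is_cring)
  note i = module_hom_id and e = D.counit_hom and B = module_base_field[OF K]
  note DC = module_tensor[OF D C]
  note E = cofree_proj_hom[OF K D C e] and E_pure = cofree_proj_pure[OF K D C e]
  let ?E = "cofree_proj K D \<epsilon> C"
  let ?ie = "tensor_map K D D D (base_field K) (\<lambda>x. x) \<epsilon>"
  note l = lcoact_DC_hom[OF assms(1) C]
  show ?thesis
  proof (rule tensor_hom_ext[OF D C DC module_hom_comp[OF l tensor_map_hom[OF D DC D C i E]] i _ t])
    fix d c assume d: "d \<in> carrier D" and c: "c \<in> carrier C"
    note pl = pure_hom_l[OF D C c]
    note Epl = module_hom_comp[OF pl E]
    have s: "\<Delta> d \<in> carrier (tensor K D D)" by (rule module_hom_mem[OF D.comult_hom d])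
    have "tensor_map K D (tensor K D C) D C (\<lambda>x. x) ?E (lcoact_DC K D \<Delta> C (pure_tensor K D C d c)) =
        tensor_map K D D D C (\<lambda>x. x) (\<lambda>y. ?E (pure_tensor K D C y c)) (\<Delta> d)"
      by (simp add: lcoact_DC_pure[OF assms(1) C d c] tensor_map_comp[OF D D D DC D C i pl i E s])
    also have "\<dots> = pure_tensor K D C (tensor_runit K D (?ie (\<Delta> d))) c"
    proof (rule tensor_hom_ext[OF D D DC tensor_map_hom[OF D D D C i Epl]
          module_hom_comp[OF tensor_map_hom[OF D D D B i e]
            module_hom_comp[OF tensor_runit_hom[OF D] pl]] _ s])
      fix x y assume x: "x \<in> carrier D" and y: "y \<in> carrier D"
      have a: "\<epsilon> y \<in> carrier K" using module_hom_mem[OF e y] by simp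
      show "tensor_map K D D D C (\<lambda>x. x) (\<lambda>y. ?E (pure_tensor K D C y c)) (pure_tensor K D D x y) =
          pure_tensor K D C (tensor_runit K D (?ie (pure_tensor K D D x y))) c"
        using x y c a
        by (simp add: tensor_map_pure[OF D D D C i Epl] E_pure tensor_map_pure[OF D D D B i e]
            tensor_runit_pure[OF D] module_hom_smult[OF pure_hom_r[OF D C x]]
            module_hom_smult[OF pl])
    qed
    also have "\<dots> = pure_tensor K D C d c" by (simp add: D.counit_right[OF d])
    finally show "tensor_map K D (tensor K D C) D C (\<lambda>x. x) ?E
      (lcoact_DC K D \<Delta> C (pure_tensor K D C d c)) = pure_tensor K D C d c" .
  qed
qed

text \<open>The uniqueness half of the universal property of the cofree comodule \<open>D \<otimes> C\<close>. Applying
  \<open>id \<otimes> (\<epsilon> \<otimes> id)\<close> to the colinearity equation of \<open>f\<close> gives back \<open>f\<close> on one side, and on the other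
  an expression in \<open>(\<epsilon> \<otimes> id) f\<close> only.\<close>

lemma colinear_into_cofree_eqI:
  assumes "coalgebra K D \<Delta> \<epsilon>" and C: "module K C" and M: "module K M"
    and l: "l \<in> module_hom K M (tensor K D M)"
    and f: "f \<in> module_hom K M (tensor K D C)"
    and f_colinear: "\<And>x. x \<in> carrier M \<Longrightarrow>
      lcoact_DC K D \<Delta> C (f x) = tensor_map K D M D (tensor K D C) (\<lambda>x. x) f (l x)"
    and g: "g \<in> module_hom K M (tensor K D C)"
    and g_colinear: "\<And>x. x \<in> carrier M \<Longrightarrow>
      lcoact_DC K D \<Delta> C (g x) = tensor_map K D M D (tensor K D C) (\<lambda>x. x) g (l x)"
    and proj_eq: "\<And>x. x \<in> carrier M \<Longrightarrow> cofree_proj K D \<epsilon> C (f x) = cofree_proj K D \<epsilon> C (g x)"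
    and m: "m \<in> carrier M"
  shows "f m = g m"
proof -
  interpret D: coalgebra K D \<Delta> \<epsilon> by fact
  have D: "module K D" by (rule D.C.module_axioms)
  note i = module_hom_id and DC = module_tensor[OF D C]
  note E = cofree_proj_hom[OF D.C.R.is_cring D C D.counit_hom]
  have lm: "l m \<in> carrier (tensor K D M)" by (rule module_hom_mem[OF l m])
  have recover: "h m = tensor_map K D M D C (\<lambda>x. x) (\<lambda>x. cofree_proj K D \<epsilon> C (h x)) (l m)"
    if h: "h \<in> module_hom K M (tensor K D C)"
      and "lcoact_DC K D \<Delta> C (h m) = tensor_map K D M D (tensor K D C) (\<lambda>x. x) h (l m)" for h
    using cofree_proj_lcoact_DC[OF assms(1) C module_hom_mem[OF h m]]
    by (simp add: that(2) tensor_map_comp[OF D M D DC D C i h i E lm])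
  show ?thesis
    unfolding recover[OF f f_colinear[OF m]] recover[OF g g_colinear[OF m]]
    by (rule tensor_map_cong[OF D M D C i module_hom_comp[OF f E] i module_hom_comp[OF g E]
          _ proj_eq lm]) simp_all
qed

section \<open>The flip\<close>

text \<open>Both sides send \<open>c \<otimes> d\<close> to \<open>d\<^sub>1 \<otimes> (d\<^sub>2 \<otimes> c)\<close>.\<close>

lemma tensor_flip_left_colinear:
  assumes "coalgebra K D \<Delta> \<epsilon>" and C: "module K C"
    and l: "lcoact_CD K C D \<Delta> \<in> module_hom K (tensor K C D) (tensor K D (tensor K C D))"
    and t: "t \<in> carrier (tensor K C D)"
  shows "lcoact_DC K D \<Delta> C (tensor_flip K C D t) =
    tensor_map K D (tensor K C D) D (tensor K D C) (\<lambda>x. x) (tensor_flip K C D)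
      (lcoact_CD K C D \<Delta> t)"
proof -
  interpret D: coalgebra K D \<Delta> \<epsilon> by fact
  have D: "module K D" by (rule D.C.module_axioms)
  note i = module_hom_id
  note DC = module_tensor[OF D C] and CD = module_tensor[OF C D]
  note \<tau> = tensor_flip_hom[OF C D] and \<tau>_pure = tensor_flip_pure[OF C D]
  note l' = lcoact_DC_hom[OF assms(1) C]
  show ?thesis
  proof (rule tensor_hom_ext[OF C D module_tensor[OF D DC] module_hom_comp[OF \<tau> l']
        module_hom_comp[OF l tensor_map_hom[OF D CD D DC i \<tau>]] _ t])
    fix c d assume c: "c \<in> carrier C" and d: "d \<in> carrier D"
    note s = module_hom_mem[OF D.comult_hom d]
    note pl = pure_hom_l[OF D C c] and pr = pure_hom_r[OF C D c]
    have "tensor_map K D D D (tensor K D C) (\<lambda>x. x) (\<lambda>y. tensor_flip K C D (pure_tensor K C D c y)) (\<Delta> d)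
        = tensor_map K D D D (tensor K D C) (\<lambda>x. x) (\<lambda>y. pure_tensor K D C y c) (\<Delta> d)"
      by (rule tensor_map_cong[OF D D D DC i module_hom_comp[OF pr \<tau>] i pl _ _ s])
         (simp_all add: \<tau>_pure c)
    then show "lcoact_DC K D \<Delta> C (tensor_flip K C D (pure_tensor K C D c d)) =
        tensor_map K D (tensor K C D) D (tensor K D C) (\<lambda>x. x) (tensor_flip K C D)
          (lcoact_CD K C D \<Delta> (pure_tensor K C D c d))"
      by (simp add: \<tau>_pure c d lcoact_DC_pure[OF assms(1) C d c] lcoact_CD_pure[OF assms(1) C c d]
          tensor_map_comp[OF D D D CD D DC i pr i \<tau> s])
  qed
qed

lemma tensor_flip_conormal:
  assumes K: "cring K" and C: "module K C" and D: "module K D"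
    and eC: "\<epsilon>C \<in> module_hom K C (base_field K)" and eD: "\<epsilon>D \<in> module_hom K D (base_field K)"
  shows "conormal K C \<epsilon>C D \<epsilon>D (tensor_flip K C D)"
proof -
  note i = module_hom_id and B = module_base_field[OF K]
  note \<tau> = tensor_flip_hom[OF C D] and \<tau>_pure = tensor_flip_pure[OF C D]
  note runit_D = module_hom_comp[OF tensor_map_hom[OF D C D B i eC] tensor_runit_hom[OF D]]
    and runit_C = module_hom_comp[OF tensor_map_hom[OF C D C B i eD] tensor_runit_hom[OF C]]
  note eC_mem = module_hom_mem[OF eC, simplified] and eD_mem = module_hom_mem[OF eD, simplified]
  show ?thesis
    unfolding conormal_def
  proof (intro conjI ballI)
    fix t assume t: "t \<in> carrier (tensor K C D)"
    show "cofree_proj K D \<epsilon>D C (tensor_flip K C D t) =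
        tensor_runit K C (tensor_map K C D C (base_field K) (\<lambda>x. x) \<epsilon>D t)"
      by (rule tensor_hom_ext[OF C D C module_hom_comp[OF \<tau> cofree_proj_hom[OF K D C eD]]
            runit_C _ t])
         (simp add: \<tau>_pure cofree_proj_pure[OF K D C eD] tensor_map_pure[OF C D C B i eD]
           tensor_runit_pure[OF C] eD_mem)
    show "tensor_runit K D (tensor_map K D C D (base_field K) (\<lambda>x. x) \<epsilon>C (tensor_flip K C D t)) =
        cofree_proj K C \<epsilon>C D t"
      by (rule tensor_hom_ext[OF C D D module_hom_comp[OF \<tau> runit_D]
            cofree_proj_hom[OF K C D eC] _ t])
         (simp add: \<tau>_pure cofree_proj_pure[OF K C D eC] tensor_map_pure[OF D C D B i eC]
           tensor_runit_pure[OF D] eC_mem)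
  qed
qed

section \<open>Conormal twists\<close>

theorem lemma4p3:
  fixes K :: "('k, 'm) ring_scheme"
    and C :: "('k, 'c, 'n) module_scheme" and D :: "('k, 'd, 'p) module_scheme"
    and \<Psi> :: "('c \<times> 'd \<Rightarrow> 'k) set \<Rightarrow> ('d \<times> 'c \<Rightarrow> 'k) set"
  assumes "field K"
    and "coalgebra K C \<Delta>C \<epsilon>C"
    and "coalgebra K D \<Delta>D \<epsilon>D"
    and "\<Psi> \<in> module_hom K (tensor K C D) (tensor K D C)"
    and "bicomodule_hom K D \<Delta>D \<epsilon>D C \<Delta>C \<epsilon>C
           (tensor K C D) (lcoact_CD K C D \<Delta>D) (rcoact_CD K C \<Delta>C D)
           (tensor K D C) (lcoact_DC K D \<Delta>D C) (rcoact_DC K D C \<Delta>C) \<Psi>"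
  shows "conormal K C \<epsilon>C D \<epsilon>D \<Psi> \<longleftrightarrow>
    (\<forall>t\<in>carrier (tensor K C D). \<Psi> t = tensor_flip K C D t)"
proof -
  interpret C: coalgebra K C \<Delta>C \<epsilon>C by fact
  interpret D: coalgebra K D \<Delta>D \<epsilon>D by fact
  interpret \<Psi>: bicomodule_hom K D \<Delta>D \<epsilon>D C \<Delta>C \<epsilon>C
    "tensor K C D" "lcoact_CD K C D \<Delta>D" "rcoact_CD K C \<Delta>C D"
    "tensor K D C" "lcoact_DC K D \<Delta>D C" "rcoact_DC K D C \<Delta>C" \<Psi> by fact
  have C: "module K C" by (rule C.C.module_axioms)
  have D: "module K D" by (rule D.C.module_axioms)
  note l = \<Psi>.M.L.lcoact_hom
  note flip = tensor_flip_conormal[OF C.C.R.is_cring C D C.counit_hom D.counit_hom]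
  show ?thesis
  proof
    assume \<Psi>: "conormal K C \<epsilon>C D \<epsilon>D \<Psi>"
    show "\<forall>t\<in>carrier (tensor K C D). \<Psi> t = tensor_flip K C D t"
    proof
      fix t assume "t \<in> carrier (tensor K C D)"
      then show "\<Psi> t = tensor_flip K C D t"
      proof (rule colinear_into_cofree_eqI[OF assms(3) C module_tensor[OF C D] l
            assms(4) \<Psi>.left_colinear tensor_flip_hom[OF C D]
            tensor_flip_left_colinear[OF assms(3) C l], rotated -1])
        fix x assume "x \<in> carrier (tensor K C D)"
        then show "cofree_proj K D \<epsilon>D C (\<Psi> x) = cofree_proj K D \<epsilon>D C (tensor_flip K C D x)"
          using \<Psi> flip by (simp add: conormal_def)
      qed
    qed
  next
    assume "\<forall>t\<in>carrier (tensor K C D). \<Psi> t = tensor_flip K C D t"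
    then show "conormal K C \<epsilon>C D \<epsilon>D \<Psi>"
      using flip by (simp add: conormal_def)
  qed
qed

end
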